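(* Let $I\subseteq\mathbb{R}$ be a nonempty open interval, let $d\ge2$, let $\mu$ and $\nu$ be probability measures on the measurable spaces $(T,\mathscr{A})$ and $(S,\mathscr{B})$, respectively, let $(f,g),(h,k)\in\mathscr{C}_1(I)$, and let $m\in\mathscr{C}_1(I^d\times T)$ and $n\in\mathscr{C}_1(I^d\times S)$ be measurable families of means. Let $x_0\in I$ and $\pmb{x}_0:=(x_0,\dots,x_0)\in I^d$. Suppose that $M_{f,g,m;\mu}$ is locally smaller than $M_{h,k,n;\nu}$ at $x_0$. Then there exists a neighborhood $U\subseteq I$ of $x_0$ such that, for all $x\in U$ and all $i\in\{1,\dots,d\}$, $$\langle\partial_i m,1\rangle_\mu(x,\dots,x)=\langle\partial_i n,1\rangle_\nu(x,\dots,x).\qquad(\ast)$$ If, in addition, $(f,g),(h,k)\in\mathscr{C}_2(I)$, $m\in\mathscr{C}_2(I^d\times T)$ and $n\in\mathscr{C}_2(I^d\times S)$, then the $(d-1)\times(d-1)$-matrix whose $(i,j)$th entry ($i,j\in\{1,\dots,d-1\}$) is $$\begin{aligned}&\big(\langle \partial_i n,\partial_j n\rangle_\nu-\langle\partial_i n,1\rangle_\nu\langle\partial_j n,1\rangle_\nu\big)(\pmb{x}_0)\,\frac{\partial_1^2\mathscr{D}_{h,k}(x_0,x_0)}{\partial_1\mathscr{D}_{h,k}(x_0,x_0)}+\langle \partial_i\partial_j n,1\rangle_\nu(\pmb{x}_0)\\&-\big(\langle \partial_i m,\partial_j m\rangle_\mu-\langle\partial_i m,1\rangle_\mu\langle\partial_j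 m,1\rangle_\mu\big)(\pmb{x}_0)\,\frac{\partial_1^2\mathscr{D}_{f,g}(x_0,x_0)}{\partial_1\mathscr{D}_{f,g}(x_0,x_0)}-\langle \partial_i\partial_j m,1\rangle_\mu(\pmb{x}_0)\end{aligned}\qquad(\ast\ast)$$ is positive semidefinite. On the other hand, if $(f,g),(h,k)\in\mathscr{C}_2(I)$, $m\in\mathscr{C}_2(I^d\times T)$, $n\in\mathscr{C}_2(I^d\times S)$, $(\ast)$ holds for all $i\in\{1,\dots,d\}$ and for all $x$ in a neighborhood of $x_0$, and the $(d-1)\times(d-1)$-matrix whose $(i,j)$th entry is given by $(\ast\ast)$ is positive definite, then $M_{f,g,m;\mu}$ is locally smaller than $M_{h,k,n;\nu}$ at $x_0$.
   Context: Means. A function $M:I^d\to I$ is a $d$-variable mean on $I$ if $\min(\pmb{x})\le M(\pmb{x})\le\max(\pmb{x})$ for all $\pmb{x}\in I^d$. $M$ is locally smaller than $N$ at $x_0\in I$ if there is a neighborhood $U\subseteq I$ of $x_0$ with $M(\pmb{x})\le N(\pmb{x})$ for all $\pmb{x}\in U^d$. Chebyshev systems. For continuous $f,g:I\to\mathbb{R}$ put $\mathscr{D}_{f,g}(x,y):=f(x)g(y)-f(y)g(x)$ ($x,y\in I$); $\partial_1$ is differentiation in the first argument, so $\partial_1\mathscr{D}_{f,g}(x,x)=f'(x)g(x)-f(x)g'(x)$ and $\partial_1^2\mathscr{D}_{f,g}(x,x)=f''(x)g(x)-f(x)g''(x)$. $(f,g)$ is a Chebyshev system on $I$ if $\mathscr{D}_{f,g}(x,y)\ne0$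 for all distinct $x,y\in I$. For $k\ge1$, $\mathscr{C}_k(I)$ is the class of Chebyshev systems $(f,g)$ on $I$ with $f,g$ $k$-times continuously differentiable and $\partial_1\mathscr{D}_{f,g}(x,x)\ne0$ for all $x\in I$. Families of means. For a measurable space $(T,\mathscr{A})$, $m:I^d\times T\to I$ is a measurable family of $d$-variable means if $m(\cdot,t)$ is a $d$-variable mean on $I$ for every $t\in T$ and $m(\pmb{x},\cdot)$ is measurable for every $\pmb{x}\in I^d$. Put $\underline{m}(\pmb{x}):=\inf_{t\in T} m(\pmb{x},t)$, $\overline{m}(\pmb{x}):=\sup_{t\in T} m(\pmb{x},t)$. The mean $M_{f,g,m;\mu}$. For a Chebyshev system $(f,g)$ on $I$ and a probability measure $\mu$ on $(T,\mathscr{A})$, $M_{f,g,m;\mu}(\pmb{x})$ is the unique $y\in[\underline{m}(\pmb{x}),\overline{m}(\pmb{x})]$ with $\int_T\mathscr{D}_{f,g}(m(\pmb{x},t),y)\,d\mu(t)=0$ (such a $y$ exists and is unique). Regularity of families, relative to the probability measure given on the parameter space. For $q\ge1$, a function $\varphi:I^d\times T\to\mathbb{R}$ is of $L^q$-type at $\pmb{p}\in I^d$ if $\varphi(\pmb{p},\cdot)$ is measurable and there exist $\delta>0$ and $a\in L^q(T,\mathscr{A},\mu)$ with $|\varphi(\pmb{x},t)|\le a(t)$ for all $t\in T$ and all $\pmb{x}\in I^d$ with $|\pmb{x}-\pmb{p}|\le\delta$. $\mathscr{C}_1(I^d\times T)$ is the class of measurable families of means $m$ such that for every $t$ the function $m(\cdot,t)$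 is continuously partially differentiable on $I^d$ and, for all $\pmb{p}\in I^d$ and all $i$, $\partial_i m$ is of $L^1$-type at $\pmb{p}$. $\mathscr{C}_2(I^d\times T)$ is the class of $m\in\mathscr{C}_1(I^d\times T)$ such that for every $t$ the function $m(\cdot,t)$ is twice continuously partially differentiable on $I^d$ and, for all $\pmb{p}\in I^d$ and all $i,j$, $\partial_i m$ is of $L^2$-type and $\partial_i\partial_j m$ is of $L^1$-type at $\pmb{p}$. For $T$ these refer to $\mu$, for $S$ to $\nu$. Here $\partial_i$ acts on the $i$th coordinate of $\pmb{x}$. Notation. $\langle\varphi,\psi\rangle_\mu(\pmb{x}):=\int_T\varphi(\pmb{x},t)\psi(\pmb{x},t)\,d\mu(t)$. *)

theory Defs
  imports "HOL-Probability.Probability"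
begin

text \<open>
  The interval \<open>I\<close> is a set of reals, and functions on \<open>I\<close> (or \<open>I\<^sup>d\<close>) are total functions of which
  only the values on \<open>I\<close> (or \<open>I\<^sup>d\<close>) matter.  Since \<open>I\<close> is always open, the two-sided derivatives
  below only see those values.  A measure \<open>\<mu>\<close> carries its parameter space as \<^term>\<open>space \<mu>\<close> and the
  sigma-algebra as \<^term>\<open>sets \<mu>\<close>.
\<close>

definition cube :: "real set \<Rightarrow> (real ^ 'd) set" where
  "cube I = {x. \<forall>i. x $ i \<in> I}"

definition diag :: "real \<Rightarrow> real ^ 'd" where
  "diag x = (\<chi> i. x)"


subsection \<open>Means\<close>

definition is_mean :: "real set \<Rightarrow> (real ^ 'd \<Rightarrow> real) \<Rightarrow> bool" where
  "is_mean I M \<longleftrightarrow>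
     (\<forall>x \<in> cube I. M x \<in> I \<and> Min (range (\<lambda>i. x $ i)) \<le> M x \<and> M x \<le> Max (range (\<lambda>i. x $ i)))"

definition locally_smaller ::
    "real set \<Rightarrow> real \<Rightarrow> (real ^ 'd \<Rightarrow> real) \<Rightarrow> (real ^ 'd \<Rightarrow> real) \<Rightarrow> bool" where
  "locally_smaller I x0 M N \<longleftrightarrow>
     (\<exists>U. open U \<and> x0 \<in> U \<and> U \<subseteq> I \<and> (\<forall>x \<in> cube U. M x \<le> N x))"

definition measurable_mean_family ::
    "real set \<Rightarrow> 't measure \<Rightarrow> (real ^ 'd \<Rightarrow> 't \<Rightarrow> real) \<Rightarrow> bool" where
  "measurable_mean_family I \<mu> m \<longleftrightarrow>
     (\<forall>t \<in> space \<mu>. is_mean I (\<lambda>x. m x t)) \<and> (\<forall>x \<in> cube I. m x \<in> borel_measurable \<mu>)"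


subsection \<open>Chebyshev systems\<close>

definition cheb_det :: "(real \<Rightarrow> real) \<Rightarrow> (real \<Rightarrow> real) \<Rightarrow> real \<Rightarrow> real \<Rightarrow> real" where
  "cheb_det f g x y = f x * g y - f y * g x"

text \<open>The \<open>j\<close>-th partial derivative of the determinant with respect to its first argument.\<close>

definition d1_cheb_det ::
    "nat \<Rightarrow> (real \<Rightarrow> real) \<Rightarrow> (real \<Rightarrow> real) \<Rightarrow> real \<Rightarrow> real \<Rightarrow> real" where
  "d1_cheb_det j f g x y = (deriv ^^ j) (\<lambda>s. cheb_det f g s y) x"

definition chebyshev_system :: "real set \<Rightarrow> (real \<Rightarrow> real) \<Rightarrow> (real \<Rightarrow> real) \<Rightarrow> bool" where
  "chebyshev_system I f g \<longleftrightarrow>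
     continuous_on I f \<and> continuous_on I g \<and>
     (\<forall>x \<in> I. \<forall>y \<in> I. x \<noteq> y \<longrightarrow> cheb_det f g x y \<noteq> 0)"

definition times_cont_diff :: "nat \<Rightarrow> real set \<Rightarrow> (real \<Rightarrow> real) \<Rightarrow> bool" where
  "times_cont_diff k I f \<longleftrightarrow>
     (\<forall>j < k. ((deriv ^^ j) f) differentiable_on I) \<and> continuous_on I ((deriv ^^ k) f)"

definition cheb_class :: "nat \<Rightarrow> real set \<Rightarrow> (real \<Rightarrow> real) \<Rightarrow> (real \<Rightarrow> real) \<Rightarrow> bool" where
  "cheb_class k I f g \<longleftrightarrow>
     chebyshev_system I f g \<and> times_cont_diff k I f \<and> times_cont_diff k I g \<and>
     (\<forall>x \<in> I. d1_cheb_det 1 f g x x \<noteq> 0)"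


subsection \<open>The means generated by a Chebyshev system and a family of means\<close>

definition gen_mean ::
    "(real \<Rightarrow> real) \<Rightarrow> (real \<Rightarrow> real) \<Rightarrow> (real ^ 'd \<Rightarrow> 't \<Rightarrow> real) \<Rightarrow> 't measure \<Rightarrow> real ^ 'd \<Rightarrow> real"
  where
  "gen_mean f g m \<mu> x =
     (THE y. y \<in> {(INF t\<in>space \<mu>. m x t)..(SUP t\<in>space \<mu>. m x t)} \<and>
             (LINT t|\<mu>. cheb_det f g (m x t) y) = 0)"


subsection \<open>Regularity of families\<close>

definition pd :: "'d \<Rightarrow> (real ^ 'd \<Rightarrow> real) \<Rightarrow> real ^ 'd \<Rightarrow> real" where
  "pd i F x = deriv (\<lambda>s. F (x + s *\<^sub>R axis i 1)) 0"

definition cont_partially_diff :: "real set \<Rightarrow> (real ^ 'd \<Rightarrow> real) \<Rightarrow> bool" where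
  "cont_partially_diff I F \<longleftrightarrow>
     (\<forall>i. (\<forall>x \<in> cube I. (\<lambda>s. F (x + s *\<^sub>R axis i 1)) differentiable at 0) \<and>
          continuous_on (cube I) (pd i F))"

definition twice_cont_partially_diff :: "real set \<Rightarrow> (real ^ 'd \<Rightarrow> real) \<Rightarrow> bool" where
  "twice_cont_partially_diff I F \<longleftrightarrow>
     cont_partially_diff I F \<and> (\<forall>j. cont_partially_diff I (pd j F))"

text \<open>Partial derivatives of a family, with respect to the coordinates of its first argument.\<close>

definition fpd :: "'d \<Rightarrow> (real ^ 'd \<Rightarrow> 't \<Rightarrow> real) \<Rightarrow> real ^ 'd \<Rightarrow> 't \<Rightarrow> real" where
  "fpd i \<phi> x t = pd i (\<lambda>z. \<phi> z t) x"

definition Lq_fun :: "real \<Rightarrow> 't measure \<Rightarrow> ('t \<Rightarrow> real) \<Rightarrow> bool" where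
  "Lq_fun q \<mu> a \<longleftrightarrow> a \<in> borel_measurable \<mu> \<and> integrable \<mu> (\<lambda>t. \<bar>a t\<bar> powr q)"

definition Lq_type_at ::
    "real \<Rightarrow> real set \<Rightarrow> 't measure \<Rightarrow> (real ^ 'd \<Rightarrow> 't \<Rightarrow> real) \<Rightarrow> real ^ 'd \<Rightarrow> bool" where
  "Lq_type_at q I \<mu> \<phi> p \<longleftrightarrow>
     \<phi> p \<in> borel_measurable \<mu> \<and>
     (\<exists>\<delta> > 0. \<exists>a. Lq_fun q \<mu> a \<and>
        (\<forall>t \<in> space \<mu>. \<forall>x \<in> cube I. norm (x - p) \<le> \<delta> \<longrightarrow> \<bar>\<phi> x t\<bar> \<le> a t))"

definition family_C1 :: "real set \<Rightarrow> 't measure \<Rightarrow> (real ^ 'd \<Rightarrow> 't \<Rightarrow> real) \<Rightarrow> bool" where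
  "family_C1 I \<mu> m \<longleftrightarrow>
     measurable_mean_family I \<mu> m \<and>
     (\<forall>t \<in> space \<mu>. cont_partially_diff I (\<lambda>x. m x t)) \<and>
     (\<forall>p \<in> cube I. \<forall>i. Lq_type_at 1 I \<mu> (fpd i m) p)"

definition family_C2 :: "real set \<Rightarrow> 't measure \<Rightarrow> (real ^ 'd \<Rightarrow> 't \<Rightarrow> real) \<Rightarrow> bool" where
  "family_C2 I \<mu> m \<longleftrightarrow>
     family_C1 I \<mu> m \<and>
     (\<forall>t \<in> space \<mu>. twice_cont_partially_diff I (\<lambda>x. m x t)) \<and>
     (\<forall>p \<in> cube I. \<forall>i j. Lq_type_at 2 I \<mu> (fpd i m) p \<and>
                            Lq_type_at 1 I \<mu> (fpd i (fpd j m)) p)"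


subsection \<open>The comparison matrix\<close>

definition bracket ::
    "'t measure \<Rightarrow> (real ^ 'd \<Rightarrow> 't \<Rightarrow> real) \<Rightarrow> (real ^ 'd \<Rightarrow> 't \<Rightarrow> real) \<Rightarrow> real ^ 'd \<Rightarrow> real" where
  "bracket \<mu> \<phi> \<psi> x = (LINT t|\<mu>. \<phi> x t * \<psi> x t)"

abbreviation one_fam :: "real ^ 'd \<Rightarrow> 't \<Rightarrow> real" where
  "one_fam \<equiv> (\<lambda>x t. 1)"

text \<open>
  To have both the dimension \<open>d\<close> and a genuine matrix of size \<open>d - 1\<close>, the coordinates of \<open>I\<^sup>d\<close> are
  indexed by \<open>'n option\<close>, where \<open>CARD('n) = d - 1 \<ge> 1\<close>: the coordinates \<open>1, \<dots>, d - 1\<close> are the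
  indices \<open>Some i\<close>, and the last coordinate is \<open>None\<close>.
\<close>

definition comparison_matrix ::
    "(real \<Rightarrow> real) \<Rightarrow> (real \<Rightarrow> real) \<Rightarrow> (real ^ 'n option \<Rightarrow> 't \<Rightarrow> real) \<Rightarrow> 't measure \<Rightarrow>
     (real \<Rightarrow> real) \<Rightarrow> (real \<Rightarrow> real) \<Rightarrow> (real ^ 'n option \<Rightarrow> 's \<Rightarrow> real) \<Rightarrow> 's measure \<Rightarrow>
     real \<Rightarrow> real ^ 'n ^ 'n" where
  "comparison_matrix f g m \<mu> h k n \<nu> x0 =
     (\<chi> i j.
        (bracket \<nu> (fpd (Some i) n) (fpd (Some j) n) (diag x0)
          - bracket \<nu> (fpd (Some i) n) one_fam (diag x0) * bracket \<nu> (fpd (Some j) n) one_fam (diag x0))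
          * (d1_cheb_det 2 h k x0 x0 / d1_cheb_det 1 h k x0 x0)
        + bracket \<nu> (fpd (Some i) (fpd (Some j) n)) one_fam (diag x0)
        - (bracket \<mu> (fpd (Some i) m) (fpd (Some j) m) (diag x0)
          - bracket \<mu> (fpd (Some i) m) one_fam (diag x0) * bracket \<mu> (fpd (Some j) m) one_fam (diag x0))
          * (d1_cheb_det 2 f g x0 x0 / d1_cheb_det 1 f g x0 x0)
        - bracket \<mu> (fpd (Some i) (fpd (Some j) m)) one_fam (diag x0))"

definition positive_semidefinite :: "real ^ 'n ^ 'n \<Rightarrow> bool" where
  "positive_semidefinite A \<longleftrightarrow> transpose A = A \<and> (\<forall>v. 0 \<le> v \<bullet> (A *v v))"

definition positive_definite :: "real ^ 'n ^ 'n \<Rightarrow> bool" where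
  "positive_definite A \<longleftrightarrow> transpose A = A \<and> (\<forall>v. v \<noteq> 0 \<longrightarrow> 0 < v \<bullet> (A *v v))"

end

theory Submission
  imports Defs
begin

text \<open>
  Near \<open>x\<^sub>0\<close> one may assume \<open>g > 0\<close>, since an invertible linear change of \<open>(f, g)\<close> does not affect the
  mean.  Then \<open>\<phi> = f / g\<close> is injective and the mean \<open>M\<close> is determined by
  \<open>\<phi> (M x) = (\<integral> f (m x t) d\<mu>) / (\<integral> g (m x t) d\<mu>)\<close>.  Differentiating this identity twice along lines,
  under the integral sign, gives the first and second directional derivatives of \<open>M\<close>; on the diagonal
  they are \<open>\<Sum>\<^sub>i v\<^sub>i \<langle>\<partial>\<^sub>i m, 1\<rangle>\<close> and the quadratic form whose difference for the two means is \<open>(\<ast>\<ast>)\<close>.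
  As \<open>N - M\<close> vanishes on the diagonal, the necessary conditions are those for a local minimum along
  lines through diagonal points.  Conversely, a positive definite \<open>(\<ast>\<ast>)\<close> makes \<open>N - M\<close> convex along
  the segments which start at a diagonal point near \<open>x\<^sub>0\<close> and keep the last coordinate fixed, and by
  \<open>(\<ast>)\<close> its derivative vanishes at the starting point.
\<close>

subsection \<open>Continuously partially differentiable functions\<close>

text \<open>A mean reproduces diagonal points: \<open>m (diag z) t = z\<close> for every
  \<open>t\<close>. On the diagonal, composites with \<open>m\<close> are therefore constant in
  \<open>t\<close> and leave the integrals, which makes the derivatives explicit there. Since
  \<open>N - M\<close> is constant along the diagonal, its second derivative degenerates in that
  direction. This is why the matrix has size d - 1: every point is reached from the diagonal point
  of its last coordinate in a direction whose last coordinate is zero.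

  The means are given implicitly, and the regularity of the families consists of integrable
  majorants near single points. Everything is therefore confined to a closed interval around the
  diagonal point: continuous functions are bounded on it, \<open>m\<close> keeps its values in it,
  and only the derivatives of \<open>m\<close> require majorants. Squares of first derivatives enter
  the second derivative of the integrals, which accounts for the L^2-type condition. Differentiating
  along lines reduces the analysis to one variable and to dominated convergence.\<close>

lemma mean_value_signed:
  fixes \<phi> :: "real \<Rightarrow> real"
  assumes "\<And>s. \<bar>s\<bar> \<le> \<bar>h\<bar> \<Longrightarrow> (\<phi> has_real_derivative \<phi>' s) (at s)"
  shows "\<exists>\<xi>. \<bar>\<xi>\<bar> \<le> \<bar>h\<bar> \<and> \<phi> h - \<phi> 0 = h * \<phi>' \<xi>"
proof (cases h "0::real" rule: linorder_cases)
  case less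
  have "\<exists>z. h < z \<and> z < 0 \<and> \<phi> 0 - \<phi> h = (0 - h) * \<phi>' z"
    by (rule MVT2[OF less]) (use assms less in auto)
  then obtain z where "h < z" "z < 0" "\<phi> 0 - \<phi> h = (0 - h) * \<phi>' z" by blast
  then show ?thesis by (intro exI[of _ z]) auto
next
  case greater
  have "\<exists>z. 0 < z \<and> z < h \<and> \<phi> h - \<phi> 0 = (h - 0) * \<phi>' z"
    by (rule MVT2[OF greater]) (use assms greater in auto)
  then obtain z where "0 < z" "z < h" "\<phi> h - \<phi> 0 = (h - 0) * \<phi>' z" by blast
  then show ?thesis by (intro exI[of _ z]) auto
qed auto

lemma open_cube: "open I \<Longrightarrow> open (cube I :: (real ^ 'd::finite) set)"
  unfolding cube_def by (rule open_vector_box) auto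

lemma cube_mono: "x \<in> cube S \<Longrightarrow> S \<subseteq> T \<Longrightarrow> x \<in> cube T"
  unfolding cube_def by blast

lemma diag_in_cube [simp]: "diag x \<in> cube I \<longleftrightarrow> x \<in> I"
  by (simp add: diag_def cube_def)

lemma diag_nth [simp]: "diag x $ i = x"
  by (simp add: diag_def)

lemma line_in_open:
  fixes p v :: "'a :: real_normed_vector"
  assumes "open S" "p \<in> S"
  shows "\<exists>\<epsilon>>0. \<forall>s. \<bar>s\<bar> < \<epsilon> \<longrightarrow> p + s *\<^sub>R v \<in> S"
proof -
  have "((\<lambda>s. p + s *\<^sub>R v) \<longlongrightarrow> p + 0 *\<^sub>R v) (nhds 0)"
    by (intro tendsto_intros filterlim_ident)
  then have "\<forall>\<^sub>F s in nhds 0. p + s *\<^sub>R v \<in> S"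
    using assms by (intro topological_tendstoD) auto
  then show ?thesis unfolding eventually_nhds_metric dist_real_def by simp
qed

text \<open>Moving the base point to \<open>p + s *\<^sub>R v\<close> turns a derivative at
  \<open>s\<close> into one at 0. Derivatives along lines thus have to be computed only at parameter
  0, for an arbitrary base point.\<close>

lemma has_real_derivative_line_shift:
  fixes F :: "'a :: real_normed_vector \<Rightarrow> real"
  assumes "((\<lambda>r. F (p + s *\<^sub>R v + r *\<^sub>R v)) has_real_derivative D) (at 0)"
  shows "((\<lambda>s. F (p + s *\<^sub>R v)) has_real_derivative D) (at s)"
proof -
  have "((\<lambda>r. F (p + s *\<^sub>R v + (r - s) *\<^sub>R v)) has_real_derivative D) (at s)"
    using DERIV_shift[of "\<lambda>r. F (p + s *\<^sub>R v + r *\<^sub>R v)" D s "-s"] assms by simp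
  then show ?thesis by (simp add: algebra_simps)
qed

lemma has_real_derivative_pd:
  fixes F :: "real ^ 'd::finite \<Rightarrow> real"
  assumes "cont_partially_diff I F" "x + s *\<^sub>R axis i 1 \<in> cube I"
  shows "((\<lambda>s. F (x + s *\<^sub>R axis i 1)) has_real_derivative pd i F (x + s *\<^sub>R axis i 1)) (at s)"
proof (rule has_real_derivative_line_shift)
  have "(\<lambda>r. F (x + s *\<^sub>R axis i 1 + r *\<^sub>R axis i 1)) differentiable at 0"
    using assms unfolding cont_partially_diff_def by blast
  then show "((\<lambda>r. F (x + s *\<^sub>R axis i 1 + r *\<^sub>R axis i 1)) has_real_derivative
      pd i F (x + s *\<^sub>R axis i 1)) (at 0)"
    unfolding pd_def by (simp add: DERIV_deriv_iff_real_differentiable)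
qed

text \<open>The coordinates of the increment are switched on one at a time. Each switch moves along
  a single axis, where the mean value theorem produces a partial derivative at an intermediate
  point; \<open>near\<close> replaces it by the one at \<open>x\<close> at the cost of
  \<open>\<epsilon>\<close>.\<close>

lemma partial_sum_increment_bound:
  fixes F :: "real ^ 'd::finite \<Rightarrow> real" and x h :: "real ^ 'd"
  assumes F: "cont_partially_diff I F"
    and near: "\<And>y i. norm (y - x) < \<delta> \<Longrightarrow> y \<in> cube I \<and> \<bar>pd i F y - pd i F x\<bar> \<le> \<epsilon>"
    and h: "norm h < \<delta>"
  shows "\<bar>F (x + (\<chi> i. if i \<in> S then h $ i else 0)) - F x - (\<Sum>i\<in>S. h $ i * pd i F x)\<bar>
           \<le> (\<Sum>i\<in>S. \<epsilon> * \<bar>h $ i\<bar>)"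
proof (induction S rule: finite_induct[OF finite])
  case 1
  have "(\<chi> i. 0) = (0 :: real ^ 'd)" by (simp add: vec_eq_iff)
  then show ?case by simp
next
  case (2 i S)
  define y where "y = x + (\<chi> j. if j \<in> S then h $ j else 0)"
  \<comment> \<open>Since \<open>i\<close> is not in \<open>S\<close>, each component of this
    displacement is bounded by that of \<open>h\<close>, so the intermediate points stay in the
    ball.\<close>
  have yx: "norm (y + r *\<^sub>R axis i 1 - x) < \<delta>" if "\<bar>r\<bar> \<le> \<bar>h $ i\<bar>" for r
  proof -
    have "norm (y + r *\<^sub>R axis i 1 - x) \<le> norm h"
      by (rule norm_le_componentwise_cart)
         (use 2 that in \<open>auto simp: y_def axis_def\<close>)
    then show ?thesis using h by simp
  qed
  have "\<exists>\<xi>. \<bar>\<xi>\<bar> \<le> \<bar>h $ i\<bar> \<and> F (y + (h $ i) *\<^sub>R axis i 1) - F (y + 0 *\<^sub>R axis i 1)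
             = h $ i * pd i F (y + \<xi> *\<^sub>R axis i 1)"
    by (rule mean_value_signed) (intro has_real_derivative_pd[OF F] conjunct1[OF near[OF yx]])
  then obtain \<xi> where \<xi>: "\<bar>\<xi>\<bar> \<le> \<bar>h $ i\<bar>"
      "F (y + (h $ i) *\<^sub>R axis i 1) - F y = h $ i * pd i F (y + \<xi> *\<^sub>R axis i 1)" by auto
  have eq: "x + (\<chi> j. if j \<in> insert i S then h $ j else 0) = y + (h $ i) *\<^sub>R axis i 1"
    using 2 by (auto simp: y_def vec_eq_iff axis_def)
  have "\<bar>h $ i * pd i F (y + \<xi> *\<^sub>R axis i 1) - h $ i * pd i F x\<bar> \<le> \<epsilon> * \<bar>h $ i\<bar>"
    using mult_right_mono[OF conjunct2[OF near[OF yx[OF \<xi>(1)], of i]], of "\<bar>h $ i\<bar>"]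
    by (simp add: right_diff_distrib[symmetric] abs_mult mult.commute)
  with 2(3) \<xi>(2) 2(1,2) show ?case
    unfolding eq by (simp add: y_def[symmetric])
qed

text \<open>The regularity assumptions speak of axis directions only, while the means are
  differentiated along arbitrary lines; total differentiability is the bridge.\<close>

lemma has_derivative_cont_partially_diff:
  fixes F :: "real ^ 'd::finite \<Rightarrow> real"
  assumes "open I" and F: "cont_partially_diff I F" and x: "x \<in> cube I"
  shows "(F has_derivative (\<lambda>h. \<Sum>i\<in>UNIV. h $ i * pd i F x)) (at x)"
  unfolding has_derivative_at_alt
proof (intro conjI allI impI)
  show "bounded_linear (\<lambda>h. \<Sum>i\<in>UNIV. h $ i * pd i F x)"
    by (intro bounded_linear_sum bounded_linear_mult_left[THEN bounded_linear_compose] bounded_linear_vec_nth)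
  fix e :: real assume "e > 0"
  \<comment> \<open>The errors of the coordinates add up, and each component of the increment is at
    most its norm.\<close>
  define \<epsilon> where "\<epsilon> = e / CARD('d)"
  have "\<epsilon> > 0" using \<open>e > 0\<close> by (simp add: \<epsilon>_def)
  have "\<forall>\<^sub>F y in nhds x. y \<in> cube I \<and> (\<forall>i. \<bar>pd i F y - pd i F x\<bar> \<le> \<epsilon>)"
  proof (intro eventually_conj eventually_all_finite)
    show "\<forall>\<^sub>F y in nhds x. y \<in> cube I"
      using open_cube[OF \<open>open I\<close>] x eventually_nhds by blast
    fix i
    have "continuous_on (cube I) (pd i F)" using F unfolding cont_partially_diff_def by blast
    then have "isCont (pd i F) x"
      using open_cube[OF \<open>open I\<close>] x continuous_on_eq_continuous_at by blast
    then have "\<forall>\<^sub>F y in nhds x. dist (pd i F y) (pd i F x) < \<epsilon>"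
      using \<open>\<epsilon> > 0\<close> by (metis isCont_def tendsto_at_iff_tendsto_nhds tendsto_iff)
    then show "\<forall>\<^sub>F y in nhds x. \<bar>pd i F y - pd i F x\<bar> \<le> \<epsilon>"
      by eventually_elim (simp add: dist_real_def)
  qed
  then obtain \<delta> where "\<delta> > 0"
    and \<delta>: "\<And>y i. norm (y - x) < \<delta> \<Longrightarrow> y \<in> cube I \<and> \<bar>pd i F y - pd i F x\<bar> \<le> \<epsilon>"
    unfolding eventually_nhds_metric dist_norm by blast
  show "\<exists>d>0. \<forall>y. norm (y - x) < d \<longrightarrow>
      norm (F y - F x - (\<Sum>i\<in>UNIV. (y - x) $ i * pd i F x)) \<le> e * norm (y - x)"
  proof (intro exI[of _ \<delta>] conjI allI impI \<open>\<delta> > 0\<close>)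
    fix y assume y: "norm (y - x) < \<delta>"
    have *: "x + (\<chi> i. if i \<in> UNIV then (y - x) $ i else 0) = y"
      by (simp add: vec_eq_iff)
    have "norm (F y - F x - (\<Sum>i\<in>UNIV. (y - x) $ i * pd i F x)) \<le> (\<Sum>i\<in>UNIV. \<epsilon> * \<bar>(y - x) $ i\<bar>)"
      using partial_sum_increment_bound[OF F \<delta> y, of UNIV] unfolding * by simp
    also have "\<dots> \<le> (\<Sum>i\<in>(UNIV::'d set). \<epsilon> * norm (y - x))"
      using \<open>\<epsilon> > 0\<close> by (intro sum_mono mult_left_mono component_le_norm_cart) auto
    also have "\<dots> = e * norm (y - x)" by (simp add: \<epsilon>_def)
    finally show "norm (F y - F x - (\<Sum>i\<in>UNIV. (y - x) $ i * pd i F x)) \<le> e * norm (y - x)" .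
  qed
qed

lemma has_real_derivative_line:
  fixes F :: "real ^ 'd::finite \<Rightarrow> real"
  assumes "open I" "cont_partially_diff I F" "p + s *\<^sub>R v \<in> cube I"
  shows "((\<lambda>s. F (p + s *\<^sub>R v)) has_real_derivative (\<Sum>i\<in>UNIV. v $ i * pd i F (p + s *\<^sub>R v))) (at s)"
proof -
  have "((\<lambda>s. p + s *\<^sub>R v) has_derivative (\<lambda>r. r *\<^sub>R v)) (at s)"
    by (auto intro!: derivative_eq_intros)
  from has_derivative_compose[OF this has_derivative_cont_partially_diff[OF assms]]
  have "((\<lambda>s. F (p + s *\<^sub>R v)) has_derivative
      (\<lambda>r. \<Sum>i\<in>UNIV. (r *\<^sub>R v) $ i * pd i F (p + s *\<^sub>R v))) (at s)" .
  moreover have "(\<lambda>r. \<Sum>i\<in>UNIV. (r *\<^sub>R v) $ i * pd i F (p + s *\<^sub>R v))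
      = (*) (\<Sum>i\<in>UNIV. v $ i * pd i F (p + s *\<^sub>R v))"
    by (auto simp: fun_eq_iff sum_distrib_left sum_distrib_right intro!: sum.cong)
  ultimately show ?thesis by (simp add: has_field_derivative_def)
qed

text \<open>\<open>?u\<close> is the increment of \<open>F\<close> in direction \<open>j\<close>, as
  a function of the displacement in direction \<open>i\<close>. The mean value theorem is applied to
  \<open>?u\<close>, and then to \<open>pd i F\<close> in direction \<open>j\<close>.\<close>

lemma second_difference_mean_value:
  fixes F :: "real ^ 'd::finite \<Rightarrow> real"
  assumes F: "twice_cont_partially_diff I F"
    and near: "\<And>a b. \<bar>a\<bar> \<le> \<bar>h\<bar> \<Longrightarrow> \<bar>b\<bar> \<le> \<bar>h\<bar> \<Longrightarrow> x + a *\<^sub>R axis i 1 + b *\<^sub>R axis j 1 \<in> cube I"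
  shows "\<exists>\<xi> \<eta>. \<bar>\<xi>\<bar> \<le> \<bar>h\<bar> \<and> \<bar>\<eta>\<bar> \<le> \<bar>h\<bar> \<and>
     F (x + h *\<^sub>R axis i 1 + h *\<^sub>R axis j 1) - F (x + h *\<^sub>R axis i 1) - F (x + h *\<^sub>R axis j 1) + F x
       = h * (h * pd j (pd i F) (x + \<xi> *\<^sub>R axis i 1 + \<eta> *\<^sub>R axis j 1))"
proof -
  have F1: "cont_partially_diff I F" and F2: "cont_partially_diff I (pd i F)"
    using F unfolding twice_cont_partially_diff_def by auto
  let ?u = "\<lambda>a. F (x + h *\<^sub>R axis j 1 + a *\<^sub>R axis i 1) - F (x + a *\<^sub>R axis i 1)"
  have "\<exists>\<xi>. \<bar>\<xi>\<bar> \<le> \<bar>h\<bar> \<and> ?u h - ?u 0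
          = h * (pd i F (x + h *\<^sub>R axis j 1 + \<xi> *\<^sub>R axis i 1) - pd i F (x + \<xi> *\<^sub>R axis i 1))"
  proof (rule mean_value_signed)
    fix s :: real assume "\<bar>s\<bar> \<le> \<bar>h\<bar>"
    then have "x + h *\<^sub>R axis j 1 + s *\<^sub>R axis i 1 \<in> cube I" "x + s *\<^sub>R axis i 1 \<in> cube I"
      using near[of s h] near[of s 0] by (simp_all add: algebra_simps)
    then show "(?u has_real_derivative
        pd i F (x + h *\<^sub>R axis j 1 + s *\<^sub>R axis i 1) - pd i F (x + s *\<^sub>R axis i 1)) (at s)"
      by (intro DERIV_diff has_real_derivative_pd[OF F1])
  qed
  then obtain \<xi> where \<xi>: "\<bar>\<xi>\<bar> \<le> \<bar>h\<bar>" "?u h - ?u 0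
          = h * (pd i F (x + h *\<^sub>R axis j 1 + \<xi> *\<^sub>R axis i 1) - pd i F (x + \<xi> *\<^sub>R axis i 1))" by blast
  have "\<exists>\<eta>. \<bar>\<eta>\<bar> \<le> \<bar>h\<bar> \<and>
      pd i F (x + \<xi> *\<^sub>R axis i 1 + h *\<^sub>R axis j 1) - pd i F (x + \<xi> *\<^sub>R axis i 1 + 0 *\<^sub>R axis j 1)
        = h * pd j (pd i F) (x + \<xi> *\<^sub>R axis i 1 + \<eta> *\<^sub>R axis j 1)"
    by (rule mean_value_signed) (intro has_real_derivative_pd[OF F2] near \<xi>)
  then obtain \<eta> where "\<bar>\<eta>\<bar> \<le> \<bar>h\<bar>"
      "pd i F (x + \<xi> *\<^sub>R axis i 1 + h *\<^sub>R axis j 1) - pd i F (x + \<xi> *\<^sub>R axis i 1)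
        = h * pd j (pd i F) (x + \<xi> *\<^sub>R axis i 1 + \<eta> *\<^sub>R axis j 1)" by auto
  then show ?thesis
    using \<xi> by (intro exI[of _ \<xi>] exI[of _ \<eta>]) (simp add: algebra_simps)
qed

text \<open>The second difference over a small square does not depend on the order of
  \<open>i\<close> and \<open>j\<close>. So the two mixed derivatives agree at a pair of points
  close to \<open>x\<close>, and continuity brings both points to \<open>x\<close>. The symmetry of
  the comparison matrix, a part of \<open>positive_semidefinite\<close>, rests on this.\<close>

lemma pd_pd_symmetric:
  fixes F :: "real ^ 'd::finite \<Rightarrow> real"
  assumes "open I" and F: "twice_cont_partially_diff I F" and x: "x \<in> cube I"
  shows "pd i (pd j F) x = pd j (pd i F) x"
proof -
  have near: "\<exists>\<delta>>0. \<forall>y. norm (y - x) < \<delta> \<longrightarrow> y \<in> cube I \<and>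
      \<bar>pd k (pd l F) y - pd k (pd l F) x\<bar> < e" if "e > 0" for e k l
  proof -
    have "continuous_on (cube I) (pd k (pd l F))"
      using F unfolding twice_cont_partially_diff_def cont_partially_diff_def by blast
    then have "isCont (pd k (pd l F)) x"
      using open_cube[OF \<open>open I\<close>] x continuous_on_eq_continuous_at by blast
    then have "\<forall>\<^sub>F y in nhds x. dist (pd k (pd l F) y) (pd k (pd l F) x) < e"
      using \<open>e > 0\<close> by (metis isCont_def tendsto_at_iff_tendsto_nhds tendsto_iff)
    moreover have "\<forall>\<^sub>F y in nhds x. y \<in> cube I"
      using open_cube[OF \<open>open I\<close>] x eventually_nhds by blast
    ultimately have "\<forall>\<^sub>F y in nhds x. y \<in> cube I \<and> \<bar>pd k (pd l F) y - pd k (pd l F) x\<bar> < e"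
      by eventually_elim (simp add: dist_real_def)
    then show ?thesis unfolding eventually_nhds_metric dist_norm by blast
  qed
  have "\<bar>pd i (pd j F) x - pd j (pd i F) x\<bar> \<le> e" if "e > 0" for e :: real
  proof -
    have "e / 2 > 0" using that by simp
    obtain \<delta>1 \<delta>2 where "\<delta>1 > 0" "\<delta>2 > 0"
      and \<delta>1: "\<And>y. norm (y - x) < \<delta>1 \<Longrightarrow> y \<in> cube I \<and> \<bar>pd i (pd j F) y - pd i (pd j F) x\<bar> < e / 2"
      and \<delta>2: "\<And>y. norm (y - x) < \<delta>2 \<Longrightarrow> y \<in> cube I \<and> \<bar>pd j (pd i F) y - pd j (pd i F) x\<bar> < e / 2"
      using near[OF \<open>e / 2 > 0\<close>] by metis
    \<comment> \<open>The points used lie at distance at most \<open>2 * h\<close> from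
      \<open>x\<close>; dividing by 3 makes this strictly smaller than both radii.\<close>
    define h where "h = min \<delta>1 \<delta>2 / 3"
    have h: "h > 0" "2 * \<bar>h\<bar> < \<delta>1" "2 * \<bar>h\<bar> < \<delta>2"
      using \<open>\<delta>1 > 0\<close> \<open>\<delta>2 > 0\<close> by (auto simp: h_def min_def)
    have small: "norm (x + a *\<^sub>R axis k 1 + b *\<^sub>R axis l 1 - x) \<le> 2 * \<bar>h\<bar>"
      if "\<bar>a\<bar> \<le> \<bar>h\<bar>" "\<bar>b\<bar> \<le> \<bar>h\<bar>" for a b :: real and k l :: 'd
    proof -
      have "norm (x + a *\<^sub>R axis k 1 + b *\<^sub>R axis l 1 - x) \<le> norm (a *\<^sub>R axis k (1::real)) + norm (b *\<^sub>R axis l (1::real))"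
        using norm_triangle_ineq[of "a *\<^sub>R axis k (1::real)" "b *\<^sub>R axis l 1"] by (simp add: algebra_simps)
      then show ?thesis using that by simp
    qed
    have inI: "x + a *\<^sub>R axis k 1 + b *\<^sub>R axis l 1 \<in> cube I"
      if "\<bar>a\<bar> \<le> \<bar>h\<bar>" "\<bar>b\<bar> \<le> \<bar>h\<bar>" for a b :: real and k l
      using \<delta>1[OF le_less_trans[OF small[OF that] h(2)]] by blast
    obtain \<xi> \<eta> where 1: "\<bar>\<xi>\<bar> \<le> \<bar>h\<bar>" "\<bar>\<eta>\<bar> \<le> \<bar>h\<bar>"
       "F (x + h *\<^sub>R axis i 1 + h *\<^sub>R axis j 1) - F (x + h *\<^sub>R axis i 1) - F (x + h *\<^sub>R axis j 1) + F x
       = h * (h * pd j (pd i F) (x + \<xi> *\<^sub>R axis i 1 + \<eta> *\<^sub>R axis j 1))"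
      using second_difference_mean_value[OF F inI] by blast
    obtain \<xi>' \<eta>' where 2: "\<bar>\<xi>'\<bar> \<le> \<bar>h\<bar>" "\<bar>\<eta>'\<bar> \<le> \<bar>h\<bar>"
       "F (x + h *\<^sub>R axis j 1 + h *\<^sub>R axis i 1) - F (x + h *\<^sub>R axis j 1) - F (x + h *\<^sub>R axis i 1) + F x
       = h * (h * pd i (pd j F) (x + \<xi>' *\<^sub>R axis j 1 + \<eta>' *\<^sub>R axis i 1))"
      using second_difference_mean_value[OF F inI] by blast
    have "x + h *\<^sub>R axis j 1 + h *\<^sub>R axis i 1 = x + h *\<^sub>R axis i 1 + h *\<^sub>R axis j 1"
      by (simp add: algebra_simps)
    then have "h * (h * pd j (pd i F) (x + \<xi> *\<^sub>R axis i 1 + \<eta> *\<^sub>R axis j 1))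
        = h * (h * pd i (pd j F) (x + \<xi>' *\<^sub>R axis j 1 + \<eta>' *\<^sub>R axis i 1))"
      unfolding 1(3)[symmetric] 2(3)[symmetric] by (simp add: algebra_simps)
    with h(1) have
      "pd j (pd i F) (x + \<xi> *\<^sub>R axis i 1 + \<eta> *\<^sub>R axis j 1) = pd i (pd j F) (x + \<xi>' *\<^sub>R axis j 1 + \<eta>' *\<^sub>R axis i 1)"
      by simp
    moreover have "\<bar>pd j (pd i F) (x + \<xi> *\<^sub>R axis i 1 + \<eta> *\<^sub>R axis j 1) - pd j (pd i F) x\<bar> < e / 2"
      using \<delta>2[OF le_less_trans[OF small[OF 1(1,2)] h(3)]] by blast
    moreover have "\<bar>pd i (pd j F) (x + \<xi>' *\<^sub>R axis j 1 + \<eta>' *\<^sub>R axis i 1) - pd i (pd j F) x\<bar> < e / 2"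
      using \<delta>1[OF le_less_trans[OF small[OF 2(1,2)] h(2)]] by blast
    ultimately show ?thesis by linarith
  qed
  then have "\<bar>pd i (pd j F) x - pd j (pd i F) x\<bar> \<le> 0" by (rule field_le_epsilon) simp
  then show ?thesis by simp
qed

subsection \<open>One-dimensional calculus\<close>

text \<open>A chain rule read backwards, since the means are accessible only through
  \<open>\<phi> (M s)\<close>. The Caratheodory slope \<open>\<eta>\<close> of \<open>\<phi>\<close>
  is continuous and nonzero at \<open>M s\<close>; dividing the difference quotient of the composite
  by \<open>\<eta> (M r)\<close> leaves that of \<open>M\<close>.\<close>

lemma has_real_derivative_of_composite:
  fixes \<phi> M :: "real \<Rightarrow> real"
  assumes \<phi>: "(\<phi> has_real_derivative D) (at (M s))" and "D \<noteq> 0"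
    and c: "((\<lambda>s. \<phi> (M s)) has_real_derivative E) (at s)"
    and M: "isCont M s"
  shows "(M has_real_derivative E / D) (at s)"
proof -
  obtain \<eta> where \<eta>: "\<And>z. \<phi> z - \<phi> (M s) = \<eta> z * (z - M s)" "isCont \<eta> (M s)" "\<eta> (M s) = D"
    using \<phi> unfolding CARAT_DERIV by blast
  have \<eta>M: "(\<lambda>r. \<eta> (M r)) \<midarrow>s\<rightarrow> D"
    using isCont_o2[OF M \<eta>(2)] \<eta>(3) by (simp add: isCont_def)
  have "(\<lambda>r. (\<phi> (M r) - \<phi> (M s)) / (r - s)) \<midarrow>s\<rightarrow> E"
    using c unfolding has_field_derivative_iff .
  then have "(\<lambda>r. (\<phi> (M r) - \<phi> (M s)) / (r - s) / \<eta> (M r)) \<midarrow>s\<rightarrow> E / D"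
    using \<eta>M \<open>D \<noteq> 0\<close> by (intro tendsto_divide)
  moreover have "\<forall>\<^sub>F r in at s. (\<phi> (M r) - \<phi> (M s)) / (r - s) / \<eta> (M r) = (M r - M s) / (r - s)"
    using tendsto_imp_eventually_ne[OF \<eta>M \<open>D \<noteq> 0\<close>]
    by eventually_elim (simp add: \<eta>(1))
  ultimately have "(\<lambda>r. (M r - M s) / (r - s)) \<midarrow>s\<rightarrow> E / D"
    by (rule Lim_transform_eventually)
  then show ?thesis unfolding has_field_derivative_iff .
qed

text \<open>An injective continuous function on a compact set has a continuous inverse on its image.
  This supplies the continuity of \<open>M\<close> that
  \<open>has_real_derivative_of_composite\<close> asks for.\<close>

lemma isCont_of_composite:
  fixes \<phi> M :: "real \<Rightarrow> real"
  assumes "compact K" "continuous_on K \<phi>" "inj_on \<phi> K"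
    and MK: "\<forall>\<^sub>F r in nhds s. M r \<in> K" and c: "isCont (\<lambda>s. \<phi> (M s)) s"
  shows "isCont M s"
proof -
  have inv: "continuous_on (\<phi> ` K) (the_inv_into K \<phi>)"
    using assms by (intro continuous_on_inv_into)
  have ev: "\<forall>\<^sub>F r in at s. M r \<in> K" and "M s \<in> K"
    using MK eventually_nhds_x_imp_x[OF MK] by (auto simp: eventually_at_filter elim: eventually_mono)
  have "((\<lambda>r. the_inv_into K \<phi> (\<phi> (M r))) \<longlongrightarrow> the_inv_into K \<phi> (\<phi> (M s))) (at s)"
    by (rule continuous_on_tendsto_compose[OF inv])
       (use c \<open>M s \<in> K\<close> ev in \<open>auto simp: isCont_def elim: eventually_mono\<close>)
  then have "((\<lambda>r. the_inv_into K \<phi> (\<phi> (M r))) \<longlongrightarrow> M s) (at s)"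
    using \<open>M s \<in> K\<close> by (simp add: the_inv_into_f_f assms(3))
  moreover have "\<forall>\<^sub>F r in at s. the_inv_into K \<phi> (\<phi> (M r)) = M r"
    using ev by eventually_elim (simp add: the_inv_into_f_f assms(3))
  ultimately have "(M \<longlongrightarrow> M s) (at s)" by (rule Lim_transform_eventually)
  then show ?thesis by (simp add: isCont_def)
qed

text \<open>If \<open>c\<close> were negative, \<open>G'\<close> would be negative just to the right
  of its zero at 0, and \<open>G\<close> would drop below \<open>G 0\<close>.\<close>

lemma second_derivative_nonneg_at_min:
  fixes G :: "real \<Rightarrow> real"
  assumes "\<delta> > 0" and G: "\<And>s. \<bar>s\<bar> < \<delta> \<Longrightarrow> (G has_real_derivative G' s) (at s)"
    and G': "(G' has_real_derivative c) (at 0)"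
    and nonneg: "\<And>s. \<bar>s\<bar> < \<delta> \<Longrightarrow> G s \<ge> 0" and "G 0 = 0"
  shows "c \<ge> 0"
proof -
  have G'0: "G' 0 = 0"
    by (rule DERIV_local_min[OF G \<open>\<delta> > 0\<close>]) (use assms in auto)
  show "c \<ge> 0"
  proof (rule ccontr)
    assume "\<not> c \<ge> 0"
    then obtain d where "d > 0" and d: "\<And>h. h > 0 \<Longrightarrow> h < d \<Longrightarrow> G' h < 0"
      using DERIV_neg_dec_right[OF G'] G'0 by (metis add_0 not_le)
    define r where "r = min d \<delta> / 2"
    have r: "r > 0" "r < d" "r < \<delta>" using \<open>d > 0\<close> \<open>\<delta> > 0\<close> by (auto simp: r_def min_def)
    have "\<exists>z. 0 < z \<and> z < r \<and> G r - G 0 = (r - 0) * G' z"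
      by (rule MVT2[OF r(1)]) (use G r in auto)
    then obtain z where "0 < z" "z < r" "G r = r * G' z" using \<open>G 0 = 0\<close> by auto
    then have "G r < 0" using d[of z] r by (simp add: mult_pos_neg)
    then show False using nonneg[of r] r by simp
  qed
qed

lemma nonneg_of_second_derivative_nonneg:
  fixes G :: "real \<Rightarrow> real"
  assumes "r \<ge> 0" and G: "\<And>s. 0 \<le> s \<Longrightarrow> s \<le> r \<Longrightarrow> (G has_real_derivative G' s) (at s)"
    and G': "\<And>s. 0 \<le> s \<Longrightarrow> s \<le> r \<Longrightarrow> (G' has_real_derivative G'' s) (at s)"
    and nonneg: "\<And>s. 0 \<le> s \<Longrightarrow> s \<le> r \<Longrightarrow> G'' s \<ge> 0" and "G 0 = 0" "G' 0 = 0"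
  shows "G r \<ge> 0"
proof -
  have "G' s \<ge> G' 0" if "0 \<le> s" "s \<le> r" for s
    by (rule DERIV_nonneg_imp_nondecreasing[OF that(1)])
       (use G' nonneg that in \<open>meson order_trans\<close>)
  then have "G r \<ge> G 0"
    using \<open>G' 0 = 0\<close>
    by (intro DERIV_nonneg_imp_nondecreasing[OF \<open>r \<ge> 0\<close>]) (metis G)
  then show ?thesis using \<open>G 0 = 0\<close> by simp
qed

text \<open>Dominated convergence for difference quotients along a sequence: by the mean value
  theorem each quotient is a value of \<open>\<phi>'\<close> at an intermediate parameter, so the
  majorant \<open>w\<close> of \<open>\<phi>'\<close> bounds it.\<close>

lemma leibniz_integral:
  fixes \<phi> \<phi>' :: "real \<Rightarrow> 'a \<Rightarrow> real"
  assumes "\<delta> > 0"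
    and der: "\<And>s t. \<bar>s\<bar> < \<delta> \<Longrightarrow> t \<in> space M \<Longrightarrow> ((\<lambda>s. \<phi> s t) has_real_derivative \<phi>' s t) (at s)"
    and int: "\<And>s. \<bar>s\<bar> < \<delta> \<Longrightarrow> integrable M (\<phi> s)"
    and meas: "\<phi>' 0 \<in> borel_measurable M"
    and w: "integrable M w" "\<And>s t. \<bar>s\<bar> < \<delta> \<Longrightarrow> t \<in> space M \<Longrightarrow> \<bar>\<phi>' s t\<bar> \<le> w t"
  shows "((\<lambda>s. LINT t|M. \<phi> s t) has_real_derivative (LINT t|M. \<phi>' 0 t)) (at 0)"
  unfolding has_field_derivative_iff tendsto_at_iff_sequentially
proof (intro allI impI)
  fix X :: "nat \<Rightarrow> real"
  assume X: "\<forall>i. X i \<in> UNIV - {0}" "X \<longlonglongrightarrow> 0"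
  then have "\<forall>\<^sub>F n in sequentially. \<bar>X n\<bar> < \<delta>"
    using \<open>\<delta> > 0\<close> by (auto simp: tendsto_iff dist_real_def)
  \<comment> \<open>Majorant and integrability are available only for parameters below
    \<open>\<delta>\<close>, so the sequence is used from index \<open>N\<close> on.\<close>
  then obtain N where N: "\<And>n. \<bar>X (n + N)\<bar> < \<delta>"
    unfolding eventually_sequentially by (metis le_add2)
  have X0: "X n \<noteq> 0" for n using X by auto
  have int0: "integrable M (\<phi> 0)" using int[of 0] \<open>\<delta> > 0\<close> by simp
  let ?q = "\<lambda>n t. (\<phi> (X (n + N)) t - \<phi> 0 t) / X (n + N)"
  have "(\<lambda>n. LINT t|M. ?q n t) \<longlonglongrightarrow> (LINT t|M. \<phi>' 0 t)"
  proof (rule integral_dominated_convergence[OF meas _ w(1)])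
    show "?q n \<in> borel_measurable M" for n
      using int[OF N, of n] int[of 0] \<open>\<delta> > 0\<close> by (auto dest!: borel_measurable_integrable)
    show "AE t in M. (\<lambda>n. ?q n t) \<longlonglongrightarrow> \<phi>' 0 t"
    proof (rule AE_I2)
      fix t assume "t \<in> space M"
      then have "(\<lambda>s. (\<phi> s t - \<phi> 0 t) / (s - 0)) \<midarrow>0\<rightarrow> \<phi>' 0 t"
        using der[of 0 t] \<open>\<delta> > 0\<close> by (simp add: has_field_derivative_iff)
      then have "((\<lambda>s. (\<phi> s t - \<phi> 0 t) / (s - 0)) \<circ> X) \<longlonglongrightarrow> \<phi>' 0 t"
        using X unfolding tendsto_at_iff_sequentially by blast
      from LIMSEQ_ignore_initial_segment[OF this, of N]
      show "(\<lambda>n. ?q n t) \<longlonglongrightarrow> \<phi>' 0 t" by (simp add: o_def)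
    qed
    show "AE t in M. norm (?q n t) \<le> w t" for n
    proof (rule AE_I2)
      fix t assume t: "t \<in> space M"
      have "\<exists>\<xi>. \<bar>\<xi>\<bar> \<le> \<bar>X (n + N)\<bar> \<and> \<phi> (X (n + N)) t - \<phi> 0 t = X (n + N) * \<phi>' \<xi> t"
        by (rule mean_value_signed) (use N[of n] in \<open>auto intro!: der t\<close>)
      then obtain \<xi> where "\<bar>\<xi>\<bar> < \<delta>" "\<phi> (X (n + N)) t - \<phi> 0 t = X (n + N) * \<phi>' \<xi> t"
        using N[of n] by (auto intro: le_less_trans)
      then show "norm (?q n t) \<le> w t" using w(2)[OF _ t] X0[of "n + N"] by simp
    qed
  qed
  moreover have "(\<lambda>n. LINT t|M. ?q n t) =
      (\<lambda>n. ((\<lambda>s. ((LINT t|M. \<phi> s t) - (LINT t|M. \<phi> 0 t)) / (s - 0)) \<circ> X) (n + N))"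
    using int[OF N] int0 by (simp add: fun_eq_iff)
  ultimately show "((\<lambda>s. ((LINT t|M. \<phi> s t) - (LINT t|M. \<phi> 0 t)) / (s - 0)) \<circ> X)
      \<longlonglongrightarrow> (LINT t|M. \<phi>' 0 t)"
    by - (rule LIMSEQ_offset[of _ N], simp only:)
qed

subsection \<open>Families of means near a diagonal point\<close>

lemma mean_in_interval:
  fixes M :: "real ^ 'd::finite \<Rightarrow> real"
  assumes "is_mean I M" "x \<in> cube I" "\<And>i. a \<le> x $ i" "\<And>i. x $ i \<le> b"
  shows "a \<le> M x" "M x \<le> b"
proof -
  have "a \<le> Min (range (\<lambda>i. x $ i))" "Max (range (\<lambda>i. x $ i)) \<le> b"
    using assms by auto
  moreover have "Min (range (\<lambda>i. x $ i)) \<le> M x" "M x \<le> Max (range (\<lambda>i. x $ i))"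
    using assms(1,2) unfolding is_mean_def by blast+
  ultimately show "a \<le> M x" "M x \<le> b" by linarith+
qed

definition ddir :: "(real ^ 'd \<Rightarrow> 't \<Rightarrow> real) \<Rightarrow> real ^ 'd \<Rightarrow> real ^ 'd \<Rightarrow> 't \<Rightarrow> real" where
  "ddir m v x t = (\<Sum>i\<in>UNIV. v $ i * fpd i m x t)"

definition ddir2 :: "(real ^ 'd \<Rightarrow> 't \<Rightarrow> real) \<Rightarrow> real ^ 'd \<Rightarrow> real ^ 'd \<Rightarrow> 't \<Rightarrow> real" where
  "ddir2 m v x t = (\<Sum>i\<in>UNIV. v $ i * (\<Sum>j\<in>UNIV. v $ j * fpd j (fpd i m) x t))"

lemma abs_weighted_sum_le:
  fixes v :: "real ^ 'd::finite"
  assumes "\<And>i. \<bar>a i\<bar> \<le> b"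
  shows "\<bar>\<Sum>i\<in>UNIV. v $ i * a i\<bar> \<le> CARD('d) * norm v * b"
proof -
  have "\<bar>\<Sum>i\<in>UNIV. v $ i * a i\<bar> \<le> (\<Sum>i\<in>UNIV. \<bar>v $ i * a i\<bar>)" by (rule sum_abs)
  also have "\<dots> \<le> (\<Sum>i\<in>(UNIV::'d set). norm v * b)"
    using assms by (intro sum_mono) (auto simp: abs_mult intro!: mult_mono component_le_norm_cart)
  finally show ?thesis by simp
qed

text \<open>The closed interval \<open>K\<close> serves to bound continuous functions of the values
  of \<open>m\<close>; derivatives are taken at points of the cube over the open interval
  \<open>J\<close>, from which lines can run both ways. A single majorant \<open>w\<close> covers
  all coordinates and the whole cube over \<open>K\<close>.\<close>

locale local_mean_family = prob_space \<mu> for \<mu> :: "'t measure" +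
  fixes I :: "real set" and m :: "real ^ 'd::finite \<Rightarrow> 't \<Rightarrow> real"
    and x0 \<delta> :: real and w :: "'t \<Rightarrow> real"
  assumes open_I: "open I"
    and family: "family_C1 I \<mu> m"
    and \<delta>: "\<delta> > 0" "{x0 - \<delta>..x0 + \<delta>} \<subseteq> I"
    and w_int: "integrable \<mu> w"
    and w_bound: "t \<in> space \<mu> \<Longrightarrow> x \<in> cube {x0 - \<delta>..x0 + \<delta>} \<Longrightarrow> \<bar>fpd i m x t\<bar> \<le> w t"
begin

abbreviation "K \<equiv> {x0 - \<delta>..x0 + \<delta>}"
abbreviation "J \<equiv> {x0 - \<delta><..<x0 + \<delta>}"

lemma cube_J_K: "x \<in> cube J \<Longrightarrow> x \<in> cube K"
  by (rule cube_mono) auto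

lemma cube_K_I: "x \<in> cube K \<Longrightarrow> x \<in> cube I"
  using \<delta>(2) by (rule cube_mono[rotated])

lemma is_mean: "t \<in> space \<mu> \<Longrightarrow> is_mean I (\<lambda>x. m x t)"
  using family unfolding family_C1_def measurable_mean_family_def by blast

lemma m_in_K: "t \<in> space \<mu> \<Longrightarrow> x \<in> cube K \<Longrightarrow> m x t \<in> K"
  using mean_in_interval[OF is_mean cube_K_I, of t x "x0 - \<delta>" "x0 + \<delta>"]
  by (auto simp: cube_def)

lemma m_diag: "t \<in> space \<mu> \<Longrightarrow> z \<in> K \<Longrightarrow> m (diag z) t = z"
  using mean_in_interval[OF is_mean cube_K_I, of t "diag z" z z]
  by (auto simp: cube_def)

lemma m_measurable: "x \<in> cube K \<Longrightarrow> m x \<in> borel_measurable \<mu>"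
  using family cube_K_I unfolding family_C1_def measurable_mean_family_def by blast

lemma fpd_measurable: "x \<in> cube K \<Longrightarrow> fpd i m x \<in> borel_measurable \<mu>"
  using family cube_K_I unfolding family_C1_def Lq_type_at_def by blast

lemma ddir_measurable: "x \<in> cube K \<Longrightarrow> ddir m v x \<in> borel_measurable \<mu>"
  unfolding ddir_def[abs_def] using fpd_measurable by measurable

lemma ddir_bound:
  "t \<in> space \<mu> \<Longrightarrow> x \<in> cube K \<Longrightarrow> \<bar>ddir m v x t\<bar> \<le> CARD('d) * norm v * w t"
  unfolding ddir_def by (intro abs_weighted_sum_le w_bound)

lemma fpd_integrable:
  assumes x: "x \<in> cube K"
  shows "integrable \<mu> (fpd i m x)"
proof (rule Bochner_Integration.integrable_bound[OF w_int fpd_measurable[OF x]], rule AE_I2)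
  show "norm (fpd i m x t) \<le> norm (w t)" if "t \<in> space \<mu>" for t
    using w_bound[OF that x, of i] by simp
qed

lemma ddir_integrable: "x \<in> cube K \<Longrightarrow> integrable \<mu> (ddir m v x)"
  unfolding ddir_def[abs_def] using fpd_integrable by simp

text \<open>\<open>F\<close> is continuous on \<open>K\<close> only. Cut off by the indicator of
  \<open>K\<close> it is Borel measurable on the whole line, and \<open>m x\<close> takes its values
  in \<open>K\<close>, where the cut-off changes nothing.\<close>

lemma composite_measurable:
  fixes F :: "real \<Rightarrow> real"
  assumes F: "continuous_on K F" and x: "x \<in> cube K"
  shows "(\<lambda>t. F (m x t)) \<in> borel_measurable \<mu>"
proof -
  have "(\<lambda>y. indicator K y *\<^sub>R F y) \<in> borel_measurable borel"
    by (rule borel_measurable_continuous_on_indicator[OF _ F]) simp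
  from measurable_compose[OF m_measurable[OF x] this]
  have "(\<lambda>t. indicator K (m x t) *\<^sub>R F (m x t)) \<in> borel_measurable \<mu>" .
  then show ?thesis
    by (rule measurable_cong[THEN iffD1, rotated]) (use m_in_K[OF _ x] in simp)
qed

lemma continuous_bound:
  fixes F :: "real \<Rightarrow> real"
  assumes "continuous_on K F"
  obtains C where "C \<ge> 0" "\<And>y. y \<in> K \<Longrightarrow> \<bar>F y\<bar> \<le> C"
proof -
  have "bounded (F ` K)" by (intro compact_imp_bounded compact_continuous_image assms) simp
  then obtain C where "\<forall>y\<in>K. \<bar>F y\<bar> \<le> C" unfolding bounded_iff by auto
  then have C: "\<bar>F y\<bar> \<le> C" if "y \<in> K" for y using that by blast
  moreover have "x0 \<in> K" using \<delta>(1) by auto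
  ultimately have "C \<ge> 0" using abs_ge_zero order_trans by blast
  then show ?thesis using C that by blast
qed

lemma composite_mult_integrable:
  assumes F: "continuous_on K F" and x: "x \<in> cube K" and \<Psi>: "integrable \<mu> \<Psi>"
  shows "integrable \<mu> (\<lambda>t. F (m x t) * \<Psi> t :: real)"
proof -
  obtain C where C: "C \<ge> 0" "\<And>y. y \<in> K \<Longrightarrow> \<bar>F y\<bar> \<le> C" using continuous_bound[OF F] by blast
  have "integrable \<mu> (\<lambda>t. C * \<Psi> t)" using \<Psi> by simp
  then show ?thesis
  proof (rule Bochner_Integration.integrable_bound)
    show "(\<lambda>t. F (m x t) * \<Psi> t) \<in> borel_measurable \<mu>"
      using composite_measurable[OF F x] \<Psi> by measurable
    show "AE t in \<mu>. norm (F (m x t) * \<Psi> t) \<le> norm (C * \<Psi> t)"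
      using C m_in_K[OF _ x] by (intro AE_I2) (simp add: abs_mult mult_right_mono)
  qed
qed

lemma composite_integrable:
  assumes "continuous_on K F" "x \<in> cube K"
  shows "integrable \<mu> (\<lambda>t. F (m x t) :: real)"
  using composite_mult_integrable[OF assms, of "\<lambda>_. 1"] by simp

lemma m_line_derivative:
  assumes "t \<in> space \<mu>" "p + s *\<^sub>R v \<in> cube K"
  shows "((\<lambda>s. m (p + s *\<^sub>R v) t) has_real_derivative ddir m v (p + s *\<^sub>R v) t) (at s)"
  using has_real_derivative_line[OF open_I, of "\<lambda>x. m x t" p s v] family assms cube_K_I[OF assms(2)]
  unfolding family_C1_def ddir_def fpd_def by blast

text \<open>A mean is squeezed between the extreme coordinates, so its distance from
  \<open>x0\<close> is at most the distance of \<open>X n\<close> from the diagonal point.\<close>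

lemma m_tendsto:
  assumes t: "t \<in> space \<mu>" and X: "\<And>n. X n \<in> cube K" "X \<longlonglongrightarrow> diag x0"
  shows "(\<lambda>n. m (X n) t) \<longlonglongrightarrow> x0"
proof (rule metric_tendsto_imp_tendsto[OF X(2)], rule always_eventually, rule allI)
  fix n
  have "x0 - norm (X n - diag x0) \<le> X n $ i \<and> X n $ i \<le> x0 + norm (X n - diag x0)" for i
    using component_le_norm_cart[of "X n - diag x0" i] by (auto simp: abs_le_iff)
  then show "dist (m (X n) t) x0 \<le> dist (X n) (diag x0)"
    using mean_in_interval[OF is_mean[OF t] cube_K_I[OF X(1)[of n]], of "x0 - norm (X n - diag x0)" "x0 + norm (X n - diag x0)"]
    by (auto simp: dist_real_def dist_norm abs_le_iff)
qed

text \<open>The limits of integrals in \<open>Q_tendsto\<close> are all instances of this: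
  \<open>\<Psi>\<close> stands for 1, for a first or second directional derivative of the family, or
  for the square of a first one, and \<open>u\<close> is a majorant uniform in
  \<open>n\<close>.\<close>

lemma integral_tendsto:
  fixes F :: "real \<Rightarrow> real"
  assumes F: "continuous_on K F" and X: "\<And>n. X n \<in> cube K" "X \<longlonglongrightarrow> diag x0"
    and \<Psi>: "\<And>n. \<Psi> n \<in> borel_measurable \<mu>" "\<And>n t. t \<in> space \<mu> \<Longrightarrow> \<bar>\<Psi> n t\<bar> \<le> u t" "integrable \<mu> u"
    and \<Psi>0: "\<And>t. t \<in> space \<mu> \<Longrightarrow> (\<lambda>n. \<Psi> n t) \<longlonglongrightarrow> \<Psi>0 t"
  shows "(\<lambda>n. LINT t|\<mu>. F (m (X n) t) * \<Psi> n t) \<longlonglongrightarrow> (LINT t|\<mu>. F (m (diag x0) t) * \<Psi>0 t)"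
proof -
  obtain C where C: "C \<ge> 0" "\<And>y. y \<in> K \<Longrightarrow> \<bar>F y\<bar> \<le> C" using continuous_bound[OF F] by blast
  have x0: "x0 \<in> K" "diag x0 \<in> cube K" using \<delta>(1) by auto
  have [measurable]: "(\<lambda>t. F (m (X n) t)) \<in> borel_measurable \<mu>" "\<Psi> n \<in> borel_measurable \<mu>"
      "\<Psi>0 \<in> borel_measurable \<mu>" "(\<lambda>t. F (m (diag x0) t)) \<in> borel_measurable \<mu>" for n
    using composite_measurable[OF F] X(1) \<Psi>(1) x0 borel_measurable_LIMSEQ_real[OF \<Psi>0 \<Psi>(1)] by auto
  show ?thesis
  proof (rule integral_dominated_convergence[where w = "\<lambda>t. C * u t"])
    show "integrable \<mu> (\<lambda>t. C * u t)" using \<Psi>(3) by simp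
    show "AE t in \<mu>. (\<lambda>n. F (m (X n) t) * \<Psi> n t) \<longlonglongrightarrow> F (m (diag x0) t) * \<Psi>0 t"
    proof (intro AE_I2 tendsto_mult \<Psi>0)
      fix t assume t: "t \<in> space \<mu>"
      show "(\<lambda>n. F (m (X n) t)) \<longlonglongrightarrow> F (m (diag x0) t)"
        unfolding m_diag[OF t x0(1)]
        by (rule continuous_on_tendsto_compose[OF F m_tendsto[OF t X] x0(1)])
           (use m_in_K[OF t X(1)] in auto)
    qed
    show "AE t in \<mu>. norm (F (m (X n) t) * \<Psi> n t) \<le> C * u t" for n
      using C \<Psi>(2) m_in_K[OF _ X(1)] by (intro AE_I2) (auto simp: abs_mult intro!: mult_mono)
  qed measurable
qed

lemma line_in_J:
  assumes "x \<in> cube J"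
  obtains \<epsilon> where "\<epsilon> > 0" "\<And>s. \<bar>s\<bar> < \<epsilon> \<Longrightarrow> x + s *\<^sub>R v \<in> cube J"
  using line_in_open[OF open_cube[OF open_greaterThanLessThan] assms] by metis

section \<open>Integrals of composites with \<open>m\<close> and their directional
  derivatives\<close>

definition I0 :: "(real \<Rightarrow> real) \<Rightarrow> real ^ 'd \<Rightarrow> real" where
  "I0 F x = (LINT t|\<mu>. F (m x t))"

text \<open>For \<open>F\<close> the derivative of a function \<open>H\<close>, this is the
  derivative of \<open>I0 H\<close> in direction \<open>v\<close>.\<close>

definition I1 :: "(real \<Rightarrow> real) \<Rightarrow> real ^ 'd \<Rightarrow> real ^ 'd \<Rightarrow> real" where
  "I1 F v x = (LINT t|\<mu>. F (m x t) * ddir m v x t)"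

lemma I0_diag: "z \<in> K \<Longrightarrow> I0 F (diag z) = F z"
  unfolding I0_def using m_diag by (simp cong: Bochner_Integration.integral_cong add: prob_space)

lemma I1_diag: "z \<in> K \<Longrightarrow> I1 F v (diag z) = F z * (LINT t|\<mu>. ddir m v (diag z) t)"
  unfolding I1_def using m_diag by (simp cong: Bochner_Integration.integral_cong)

lemma I0_derivative:
  assumes F: "\<And>y. y \<in> K \<Longrightarrow> (F has_real_derivative F1 y) (at y)" and F1: "continuous_on K F1"
    and x: "x \<in> cube J"
  shows "((\<lambda>s. I0 F (x + s *\<^sub>R v)) has_real_derivative I1 F1 v x) (at 0)"
proof -
  obtain \<epsilon> where \<epsilon>: "\<epsilon> > 0" "\<And>s. \<bar>s\<bar> < \<epsilon> \<Longrightarrow> x + s *\<^sub>R v \<in> cube K"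
    using line_in_J[OF x] cube_J_K by metis
  obtain C where C: "C \<ge> 0" "\<And>y. y \<in> K \<Longrightarrow> \<bar>F1 y\<bar> \<le> C" using continuous_bound[OF F1] by blast
  have Fc: "continuous_on K F"
    using F by (intro continuous_at_imp_continuous_on) (blast intro: DERIV_isCont)
  have "((\<lambda>s. LINT t|\<mu>. F (m (x + s *\<^sub>R v) t)) has_real_derivative
      (LINT t|\<mu>. F1 (m (x + 0 *\<^sub>R v) t) * ddir m v (x + 0 *\<^sub>R v) t)) (at 0)"
  proof (rule leibniz_integral[OF \<epsilon>(1), where w = "\<lambda>t. C * (CARD('d) * norm v * w t)"])
    fix s :: real and t assume s: "\<bar>s\<bar> < \<epsilon>" and t: "t \<in> space \<mu>"
    show "((\<lambda>s. F (m (x + s *\<^sub>R v) t)) has_real_derivative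
        F1 (m (x + s *\<^sub>R v) t) * ddir m v (x + s *\<^sub>R v) t) (at s)"
      by (rule DERIV_chain2[where f = F and g = "\<lambda>s. m (x + s *\<^sub>R v) t",
            OF F[OF m_in_K[OF t \<epsilon>(2)[OF s]]] m_line_derivative[OF t \<epsilon>(2)[OF s]]])
    show "\<bar>F1 (m (x + s *\<^sub>R v) t) * ddir m v (x + s *\<^sub>R v) t\<bar> \<le> C * (CARD('d) * norm v * w t)"
      unfolding abs_mult
      using C(1) C(2)[OF m_in_K[OF t \<epsilon>(2)[OF s]]] ddir_bound[OF t \<epsilon>(2)[OF s], of v] by (intro mult_mono) auto
  next
    show "(\<lambda>t. F1 (m (x + 0 *\<^sub>R v) t) * ddir m v (x + 0 *\<^sub>R v) t) \<in> borel_measurable \<mu>"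
      using \<epsilon>(1) by (intro borel_measurable_times composite_measurable[OF F1] ddir_measurable \<epsilon>(2)) auto
    show "integrable \<mu> (\<lambda>t. F (m (x + s *\<^sub>R v) t))" if "\<bar>s\<bar> < \<epsilon>" for s
      by (rule composite_integrable[OF Fc \<epsilon>(2)[OF that]])
  qed (use w_int in simp)
  then show ?thesis unfolding I0_def I1_def by simp
qed

end

subsection \<open>First derivatives of the generated mean\<close>

text \<open>The derivatives \<open>f1\<close> and \<open>g1\<close> are parameters because the
  locale is applied to linear combinations of the original generators, whose derivatives are then
  the same combinations of \<open>deriv f\<close> and \<open>deriv g\<close>.\<close>

locale local_generated_mean = local_mean_family \<mu> I m x0 \<delta> w
  for \<mu> :: "'t measure" and I and m :: "real ^ 'd::finite \<Rightarrow> 't \<Rightarrow> real" and x0 \<delta> w +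
  fixes f g f1 g1 :: "real \<Rightarrow> real"
  assumes f_der: "y \<in> I \<Longrightarrow> (f has_real_derivative f1 y) (at y)" and f1_cont: "continuous_on I f1"
    and g_der: "y \<in> I \<Longrightarrow> (g has_real_derivative g1 y) (at y)" and g1_cont: "continuous_on I g1"
    and cheb: "y \<in> I \<Longrightarrow> z \<in> I \<Longrightarrow> y \<noteq> z \<Longrightarrow> cheb_det f g y z \<noteq> 0"
    and wronskian: "y \<in> I \<Longrightarrow> f1 y * g y - f y * g1 y \<noteq> 0"
    and g_pos: "y \<in> {x0 - \<delta>..x0 + \<delta>} \<Longrightarrow> g y > 0"
begin

abbreviation "W y \<equiv> f1 y * g y - f y * g1 y"
abbreviation "M \<equiv> gen_mean f g m \<mu>"

lemma f_cont: "continuous_on K f"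
  by (intro continuous_at_imp_continuous_on ballI DERIV_isCont[OF f_der] subsetD[OF \<delta>(2)])

lemma g_cont: "continuous_on K g"
  by (intro continuous_at_imp_continuous_on ballI DERIV_isCont[OF g_der] subsetD[OF \<delta>(2)])

lemma f1_cont_K: "continuous_on K f1" and g1_cont_K: "continuous_on K g1"
  using f1_cont g1_cont \<delta>(2) continuous_on_subset by blast+

lemma ratio_inj: "inj_on (\<lambda>y. f y / g y) K"
proof (rule inj_onI, rule ccontr)
  fix y z assume yz: "y \<in> K" "z \<in> K" "f y / g y = f z / g z" "y \<noteq> z"
  then have "f y * g z - f z * g y = 0"
    using g_pos[OF yz(1)] g_pos[OF yz(2)] by (simp add: field_simps)
  then show False using cheb[of y z] yz \<delta>(2) unfolding cheb_det_def by blast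
qed

lemma ratio_cont: "continuous_on K (\<lambda>y. f y / g y)"
  using f_cont g_cont g_pos by (intro continuous_on_divide) (auto simp: less_imp_neq[symmetric])

text \<open>A nonnegative integrand with integral 0 vanishes almost everywhere; here it is positive
  everywhere, and a probability space is not a null set.\<close>

lemma I0_g_pos:
  assumes x: "x \<in> cube K"
  shows "I0 g x > 0"
proof -
  have "I0 g x \<ge> 0" unfolding I0_def
    using g_pos[OF m_in_K[OF _ x]] by (intro integral_nonneg_AE AE_I2) (auto simp: less_imp_le)
  moreover have "I0 g x \<noteq> 0"
  proof
    assume "I0 g x = 0"
    then have "AE t in \<mu>. g (m x t) = 0"
      unfolding I0_def
      by (subst (asm) integral_nonneg_eq_0_iff_AE[OF composite_integrable[OF g_cont x]])
         (use g_pos[OF m_in_K[OF _ x]] in \<open>auto simp: less_imp_le\<close>)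
    then have "AE t in \<mu>. False"
    proof (rule AE_mp, intro AE_I2 impI)
      fix t assume "t \<in> space \<mu>" "g (m x t) = 0"
      then show False using g_pos[OF m_in_K[OF _ x]] by (metis less_irrefl)
    qed
    then show False by simp
  qed
  ultimately show ?thesis by simp
qed

lemma integral_cheb_det:
  assumes "x \<in> cube K"
  shows "(LINT t|\<mu>. cheb_det f g (m x t) y) = I0 f x * g y - f y * I0 g x"
  unfolding cheb_det_def I0_def
  using composite_integrable[OF f_cont assms] composite_integrable[OF g_cont assms] by simp

text \<open>The quotient of the integrals is the average of \<open>f / g\<close> over the values
  \<open>m x t\<close> with the positive weights \<open>g (m x t)\<close>. It therefore lies between
  the extreme values of \<open>f / g\<close> on \<open>{a..b}\<close>, and the continuous image of
  this interval is an interval.\<close>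

lemma ratio_root_exists:
  assumes x: "x \<in> cube K" and a: "a \<le> b" "{a..b} \<subseteq> K" and m: "\<And>t. t \<in> space \<mu> \<Longrightarrow> m x t \<in> {a..b}"
  shows "\<exists>y\<in>{a..b}. f y / g y = I0 f x / I0 g x"
proof -
  let ?\<phi> = "\<lambda>y. f y / g y"
  have "continuous_on {a..b} ?\<phi>" using ratio_cont a(2) continuous_on_subset by blast
  then obtain c d where cd: "?\<phi> ` {a..b} = {c..d}"
    using continuous_image_closed_interval[OF a(1)] by blast
  have int: "integrable \<mu> (\<lambda>t. f (m x t))" "integrable \<mu> (\<lambda>t. g (m x t))"
    using composite_integrable[OF f_cont x] composite_integrable[OF g_cont x] by auto
  have *: "c * g (m x t) \<le> f (m x t) \<and> f (m x t) \<le> d * g (m x t)" if t: "t \<in> space \<mu>" for t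
  proof -
    have "?\<phi> (m x t) \<in> {c..d}" using m[OF t] cd by blast
    then show ?thesis using g_pos[OF m_in_K[OF t x]] by (simp add: field_simps)
  qed
  have "(LINT t|\<mu>. c * g (m x t)) \<le> I0 f x"
    unfolding I0_def by (intro integral_mono) (use int * in auto)
  moreover have "I0 f x \<le> (LINT t|\<mu>. d * g (m x t))"
    unfolding I0_def by (intro integral_mono) (use int * in auto)
  ultimately have "I0 f x / I0 g x \<in> {c..d}"
    using I0_g_pos[OF x] int by (simp add: I0_def field_simps)
  then show ?thesis unfolding cd[symmetric] by auto
qed

text \<open>This resolves the definite description in \<open>gen_mean_def\<close>. Where
  \<open>g\<close> is positive, the vanishing of the integral is an equation for
  \<open>f / g\<close>, which \<open>ratio_root_exists\<close> solves and \<open>ratio_inj\<close>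
  makes uniquely solvable.\<close>

lemma M_properties:
  assumes x: "x \<in> cube K"
  shows "M x \<in> {(INF t\<in>space \<mu>. m x t)..(SUP t\<in>space \<mu>. m x t)}"
    and "{(INF t\<in>space \<mu>. m x t)..(SUP t\<in>space \<mu>. m x t)} \<subseteq> K"
    and "f (M x) / g (M x) = I0 f x / I0 g x"
proof -
  define a b where "a = (INF t\<in>space \<mu>. m x t)" and "b = (SUP t\<in>space \<mu>. m x t)"
  have ne: "space \<mu> \<noteq> {}" by (rule not_empty)
  have bdd: "bdd_below (m x ` space \<mu>)" "bdd_above (m x ` space \<mu>)"
    using m_in_K[OF _ x] by (fastforce intro: bdd_belowI2[of _ "x0 - \<delta>"], fastforce intro: bdd_aboveI2[of _ _ "x0 + \<delta>"])
  have m_ab: "m x t \<in> {a..b}" if "t \<in> space \<mu>" for t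
    using that bdd by (auto simp: a_def b_def intro: cINF_lower cSUP_upper)
  have "x0 - \<delta> \<le> a" "b \<le> x0 + \<delta>"
    using m_in_K[OF _ x] ne by (auto simp: a_def b_def intro!: cINF_greatest cSUP_least)
  then have abK: "{a..b} \<subseteq> K" by auto
  have "a \<le> b" using m_ab ne by fastforce
  have iff: "(LINT t|\<mu>. cheb_det f g (m x t) y) = 0 \<longleftrightarrow> f y / g y = I0 f x / I0 g x" if "y \<in> K" for y
    using g_pos[OF that] I0_g_pos[OF x] unfolding integral_cheb_det[OF x] by (auto simp: field_simps)
  obtain y where y: "y \<in> {a..b}" "f y / g y = I0 f x / I0 g x"
    using ratio_root_exists[OF x \<open>a \<le> b\<close> abK m_ab] by blast
  have "M x = y"
    unfolding gen_mean_def a_def[symmetric] b_def[symmetric]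
  proof (rule the_equality)
    show "y \<in> {a..b} \<and> (LINT t|\<mu>. cheb_det f g (m x t) y) = 0" using y iff abK by blast
    fix z assume "z \<in> {a..b} \<and> (LINT t|\<mu>. cheb_det f g (m x t) z) = 0"
    then have "z \<in> K" "f z / g z = f y / g y" using iff abK y by auto
    then show "z = y" using inj_onD[OF ratio_inj] y abK by blast
  qed
  then show "M x \<in> {a..b}" "{a..b} \<subseteq> K" "f (M x) / g (M x) = I0 f x / I0 g x"
    using y abK by auto
qed

lemma M_in_K: "x \<in> cube K \<Longrightarrow> M x \<in> K"
  using M_properties(1,2) by blast

lemma M_between:
  assumes x: "x \<in> cube K" and "\<And>i. a \<le> x $ i" "\<And>i. x $ i \<le> b"
  shows "a \<le> M x" "M x \<le> b"
proof -
  have "a \<le> m x t \<and> m x t \<le> b" if "t \<in> space \<mu>" for t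
    using mean_in_interval[OF is_mean[OF that] cube_K_I[OF x]] assms by blast
  then have "a \<le> (INF t\<in>space \<mu>. m x t)" "(SUP t\<in>space \<mu>. m x t) \<le> b"
    using not_empty by (auto intro!: cINF_greatest cSUP_least)
  then show "a \<le> M x" "M x \<le> b" using M_properties(1)[OF x] by auto
qed

lemma M_diag: "z \<in> K \<Longrightarrow> M (diag z) = z"
  using M_between[of "diag z" z z] by (simp add: antisym)

text \<open>
  The derivative of \<open>M\<close> in direction \<open>v\<close>: that of the quotient \<open>I0 f / I0 g\<close>, divided by
  \<open>(f / g)' = W / g\<^sup>2\<close> at \<open>M x\<close>.
\<close>

definition P :: "real ^ 'd \<Rightarrow> real ^ 'd \<Rightarrow> real" where
  "P v x = (I1 f1 v x * I0 g x - I0 f x * I1 g1 v x) * (g (M x))\<^sup>2 / ((I0 g x)\<^sup>2 * W (M x))"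

lemma I0_f_derivative: "x \<in> cube J \<Longrightarrow> ((\<lambda>s. I0 f (x + s *\<^sub>R v)) has_real_derivative I1 f1 v x) (at 0)"
  and I0_g_derivative: "x \<in> cube J \<Longrightarrow> ((\<lambda>s. I0 g (x + s *\<^sub>R v)) has_real_derivative I1 g1 v x) (at 0)"
  by (intro I0_derivative f_der g_der f1_cont_K g1_cont_K subsetD[OF \<delta>(2)]; assumption)+

lemma M_derivative:
  assumes x: "x \<in> cube J"
  shows "((\<lambda>s. M (x + s *\<^sub>R v)) has_real_derivative P v x) (at 0)"
proof -
  let ?\<phi> = "\<lambda>y. f y / g y"
  obtain \<epsilon> where \<epsilon>: "\<epsilon> > 0" "\<And>s. \<bar>s\<bar> < \<epsilon> \<Longrightarrow> x + s *\<^sub>R v \<in> cube K"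
    using line_in_J[OF x] cube_J_K by metis
  have xK: "x \<in> cube K" using x by (rule cube_J_K)
  have gM: "g (M x) > 0" by (intro g_pos M_in_K xK)
  have MI: "M x \<in> I" using M_in_K[OF xK] \<delta>(2) by blast
  have near: "\<forall>\<^sub>F s in nhds 0. x + s *\<^sub>R v \<in> cube K"
    unfolding eventually_nhds_metric using \<epsilon> by (auto simp: dist_real_def)
  have "((\<lambda>s. I0 f (x + s *\<^sub>R v) / I0 g (x + s *\<^sub>R v)) has_real_derivative
      (I1 f1 v x * I0 g x - I0 f x * I1 g1 v x) / (I0 g x * I0 g x)) (at 0)"
    using DERIV_divide[OF I0_f_derivative[OF x] I0_g_derivative[OF x], of v v] I0_g_pos[OF xK] by simp
  \<comment> \<open>The identity from \<open>M_properties\<close> is available as long as the line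
    stays in the cube over \<open>K\<close>, that is, for \<open>s\<close> near 0.\<close>
  then have comp: "((\<lambda>s. ?\<phi> (M (x + s *\<^sub>R v))) has_real_derivative
      (I1 f1 v x * I0 g x - I0 f x * I1 g1 v x) / (I0 g x * I0 g x)) (at 0)"
    by (rule DERIV_cong_ev[THEN iffD1, rotated -1])
       (use near in \<open>auto simp: M_properties(3) elim: eventually_mono\<close>)
  have \<phi>: "(?\<phi> has_real_derivative W (M x) / (g (M x) * g (M x))) (at (M x))"
    using gM by (intro DERIV_divide f_der g_der MI) auto
  \<comment> \<open>Continuity has to come before differentiability: the backward chain rule
    evaluates a slope along \<open>M (x + s *\<^sub>R v)\<close> and passes to its limit.\<close>
  have "isCont (\<lambda>s. M (x + s *\<^sub>R v)) 0"
    by (rule isCont_of_composite[OF compact_Icc ratio_cont ratio_inj])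
       (rule eventually_mono[OF near M_in_K], assumption, rule DERIV_isCont[OF comp])
  then have "((\<lambda>s. M (x + s *\<^sub>R v)) has_real_derivative
     (I1 f1 v x * I0 g x - I0 f x * I1 g1 v x) / (I0 g x * I0 g x) / (W (M x) / (g (M x) * g (M x)))) (at 0)"
    by (intro has_real_derivative_of_composite[where M = "\<lambda>s. M (x + s *\<^sub>R v)", OF _ _ comp]) (use \<phi> gM wronskian[OF MI] in auto)
  then show ?thesis by (simp add: P_def power2_eq_square)
qed

text \<open>On the diagonal the numerator of \<open>P\<close> is \<open>W z * (g z)\<^sup>2\<close>
  times the integral of \<open>ddir m v\<close>. The factor cancels against the denominator, so the
  first derivative depends on the family and the measure alone.\<close>

lemma P_diag: "z \<in> K \<Longrightarrow> P v (diag z) = (LINT t|\<mu>. ddir m v (diag z) t)"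
proof -
  assume z: "z \<in> K"
  have "W z \<noteq> 0" "g z > 0" using z \<delta>(2) wronskian g_pos by blast+
  then show ?thesis
    unfolding P_def M_diag[OF z] I0_diag[OF z] I1_diag[OF z]
    by (simp add: divide_simps) (simp add: algebra_simps power2_eq_square)
qed

end

subsection \<open>Second derivatives of the generated mean\<close>

text \<open>\<open>w2\<close> dominates the squares of the first derivatives as well as the second
  derivatives, since both appear when \<open>F (m x t)\<close> is differentiated twice along a
  line.\<close>

locale local_generated_mean_C2 = local_generated_mean \<mu> I m x0 \<delta> w f g f1 g1
  for \<mu> :: "'t measure" and I and m :: "real ^ 'd::finite \<Rightarrow> 't \<Rightarrow> real" and x0 \<delta> w f g f1 g1 +
  fixes f2 g2 :: "real \<Rightarrow> real" and w2 :: "'t \<Rightarrow> real"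
  assumes f1_der: "y \<in> I \<Longrightarrow> (f1 has_real_derivative f2 y) (at y)" and f2_cont: "continuous_on I f2"
    and g1_der: "y \<in> I \<Longrightarrow> (g1 has_real_derivative g2 y) (at y)" and g2_cont: "continuous_on I g2"
    and family2: "family_C2 I \<mu> m"
    and w2_int: "integrable \<mu> w2"
    and w2_bound1: "t \<in> space \<mu> \<Longrightarrow> x \<in> cube {x0 - \<delta>..x0 + \<delta>} \<Longrightarrow> (fpd i m x t)\<^sup>2 \<le> w2 t"
    and w2_bound2: "t \<in> space \<mu> \<Longrightarrow> x \<in> cube {x0 - \<delta>..x0 + \<delta>} \<Longrightarrow> \<bar>fpd j (fpd i m) x t\<bar> \<le> w2 t"
begin

lemma f2_cont_K: "continuous_on K f2" and g2_cont_K: "continuous_on K g2"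
  using f2_cont g2_cont \<delta>(2) continuous_on_subset by blast+

lemma ddir2_measurable: "x \<in> cube K \<Longrightarrow> ddir2 m v x \<in> borel_measurable \<mu>"
proof -
  assume "x \<in> cube K"
  then have [measurable]: "fpd j (fpd i m) x \<in> borel_measurable \<mu>" for i j
    using family2 cube_K_I unfolding family_C2_def Lq_type_at_def by blast
  show ?thesis unfolding ddir2_def[abs_def] by measurable
qed

lemma ddir_square_bound:
  assumes "t \<in> space \<mu>" "x \<in> cube K"
  shows "\<bar>(ddir m v x t)\<^sup>2\<bar> \<le> (CARD('d) * norm v)\<^sup>2 * w2 t"
proof -
  have "w2 t \<ge> 0" using w2_bound1[OF assms] zero_le_power2 order_trans by blast
  have "\<bar>fpd i m x t\<bar> \<le> sqrt (w2 t)" for i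
    using w2_bound1[OF assms, of i] by (simp add: real_le_rsqrt)
  then have "\<bar>ddir m v x t\<bar> \<le> CARD('d) * norm v * sqrt (w2 t)"
    unfolding ddir_def by (rule abs_weighted_sum_le)
  then have "\<bar>ddir m v x t\<bar>\<^sup>2 \<le> (CARD('d) * norm v * sqrt (w2 t))\<^sup>2"
    by (intro power_mono) auto
  then show ?thesis using \<open>w2 t \<ge> 0\<close> by (simp add: power_mult_distrib)
qed

lemma ddir2_bound:
  assumes "t \<in> space \<mu>" "x \<in> cube K"
  shows "\<bar>ddir2 m v x t\<bar> \<le> (CARD('d) * norm v)\<^sup>2 * w2 t"
proof -
  have "\<bar>ddir2 m v x t\<bar> \<le> CARD('d) * norm v * (CARD('d) * norm v * w2 t)"
    unfolding ddir2_def by (intro abs_weighted_sum_le w2_bound2 assms)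
  then show ?thesis by (simp add: power2_eq_square mult.assoc)
qed

lemma ddir_square_integrable:
  assumes x: "x \<in> cube K"
  shows "integrable \<mu> (\<lambda>t. (ddir m v x t)\<^sup>2)"
proof (rule Bochner_Integration.integrable_bound)
  show "integrable \<mu> (\<lambda>t. (CARD('d) * norm v)\<^sup>2 * w2 t)" using w2_int by simp
  show "AE t in \<mu>. norm ((ddir m v x t)\<^sup>2) \<le> norm ((CARD('d) * norm v)\<^sup>2 * w2 t)"
    unfolding real_norm_def by (intro AE_I2 order_trans[OF ddir_square_bound abs_ge_self] x)
qed (use ddir_measurable[OF x] in measurable)

lemma ddir2_integrable:
  assumes x: "x \<in> cube K"
  shows "integrable \<mu> (ddir2 m v x)"
proof (rule Bochner_Integration.integrable_bound)
  show "integrable \<mu> (\<lambda>t. (CARD('d) * norm v)\<^sup>2 * w2 t)" using w2_int by simp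
  show "AE t in \<mu>. norm (ddir2 m v x t) \<le> norm ((CARD('d) * norm v)\<^sup>2 * w2 t)"
    unfolding real_norm_def by (intro AE_I2 order_trans[OF ddir2_bound abs_ge_self] x)
qed (rule ddir2_measurable[OF x])

lemma ddir_line_derivative:
  assumes "t \<in> space \<mu>" "p + s *\<^sub>R v \<in> cube K"
  shows "((\<lambda>s. ddir m v (p + s *\<^sub>R v) t) has_real_derivative ddir2 m v (p + s *\<^sub>R v) t) (at s)"
proof -
  have "cont_partially_diff I (pd i (\<lambda>x. m x t))" for i
    using family2 assms(1) unfolding family_C2_def twice_cont_partially_diff_def by blast
  from has_real_derivative_line[OF open_I this cube_K_I[OF assms(2)]]
  show ?thesis
    unfolding ddir_def ddir2_def fpd_def by (intro DERIV_sum DERIV_cmult)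
qed

text \<open>The derivative of \<open>I1 F v\<close> in direction \<open>v\<close> when
  \<open>F1\<close> is the derivative of \<open>F\<close>. The two integrals are kept apart because
  each takes its own \<open>\<Psi>\<close> in \<open>integral_tendsto\<close>.\<close>

definition I2 :: "(real \<Rightarrow> real) \<Rightarrow> (real \<Rightarrow> real) \<Rightarrow> real ^ 'd \<Rightarrow> real ^ 'd \<Rightarrow> real" where
  "I2 F F1 v x = (LINT t|\<mu>. F1 (m x t) * (ddir m v x t)\<^sup>2) + (LINT t|\<mu>. F (m x t) * ddir2 m v x t)"

lemma I2_diag:
  "z \<in> K \<Longrightarrow> I2 F F1 v (diag z) =
     F1 z * (LINT t|\<mu>. (ddir m v (diag z) t)\<^sup>2) + F z * (LINT t|\<mu>. ddir2 m v (diag z) t)"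
  unfolding I2_def using m_diag by (simp cong: Bochner_Integration.integral_cong)

lemma I1_derivative:
  assumes F: "\<And>y. y \<in> K \<Longrightarrow> (F has_real_derivative F1 y) (at y)" and F1: "continuous_on K F1"
    and x: "x \<in> cube J"
  shows "((\<lambda>s. I1 F v (x + s *\<^sub>R v)) has_real_derivative I2 F F1 v x) (at 0)"
proof -
  obtain \<epsilon> where \<epsilon>: "\<epsilon> > 0" "\<And>s. \<bar>s\<bar> < \<epsilon> \<Longrightarrow> x + s *\<^sub>R v \<in> cube K"
    using line_in_J[OF x] cube_J_K by metis
  have Fc: "continuous_on K F"
    using F by (intro continuous_at_imp_continuous_on) (blast intro: DERIV_isCont)
  obtain C where C: "C \<ge> 0" "\<And>y. y \<in> K \<Longrightarrow> \<bar>F y\<bar> \<le> C" using continuous_bound[OF Fc] by blast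
  obtain C1 where C1: "C1 \<ge> 0" "\<And>y. y \<in> K \<Longrightarrow> \<bar>F1 y\<bar> \<le> C1" using continuous_bound[OF F1] by blast
  have x0: "x + 0 *\<^sub>R v \<in> cube K" using cube_J_K[OF x] by simp
  have "((\<lambda>s. LINT t|\<mu>. F (m (x + s *\<^sub>R v) t) * ddir m v (x + s *\<^sub>R v) t) has_real_derivative
      (LINT t|\<mu>. F1 (m (x + 0 *\<^sub>R v) t) * (ddir m v (x + 0 *\<^sub>R v) t)\<^sup>2
               + F (m (x + 0 *\<^sub>R v) t) * ddir2 m v (x + 0 *\<^sub>R v) t)) (at 0)"
  proof (rule leibniz_integral[OF \<epsilon>(1), where w = "\<lambda>t. C1 * ((CARD('d) * norm v)\<^sup>2 * w2 t) + C * ((CARD('d) * norm v)\<^sup>2 * w2 t)"])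
    fix s :: real and t assume s: "\<bar>s\<bar> < \<epsilon>" and t: "t \<in> space \<mu>"
    note K = \<epsilon>(2)[OF s]
    have "((\<lambda>s. F (m (x + s *\<^sub>R v) t)) has_real_derivative
        F1 (m (x + s *\<^sub>R v) t) * ddir m v (x + s *\<^sub>R v) t) (at s)"
      by (rule DERIV_chain2[where f = F and g = "\<lambda>s. m (x + s *\<^sub>R v) t",
            OF F[OF m_in_K[OF t K]] m_line_derivative[OF t K]])
    from DERIV_mult[OF this ddir_line_derivative[OF t K]]
    show "((\<lambda>s. F (m (x + s *\<^sub>R v) t) * ddir m v (x + s *\<^sub>R v) t) has_real_derivative
        F1 (m (x + s *\<^sub>R v) t) * (ddir m v (x + s *\<^sub>R v) t)\<^sup>2
               + F (m (x + s *\<^sub>R v) t) * ddir2 m v (x + s *\<^sub>R v) t) (at s)"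
      by (simp add: power2_eq_square algebra_simps)
    have "\<bar>F1 (m (x + s *\<^sub>R v) t) * (ddir m v (x + s *\<^sub>R v) t)\<^sup>2\<bar> \<le> C1 * ((CARD('d) * norm v)\<^sup>2 * w2 t)"
      unfolding abs_mult[of "F1 _"]
      by (intro mult_mono C1 m_in_K[OF t K] ddir_square_bound[OF t K]) auto
    moreover have "\<bar>F (m (x + s *\<^sub>R v) t) * ddir2 m v (x + s *\<^sub>R v) t\<bar> \<le> C * ((CARD('d) * norm v)\<^sup>2 * w2 t)"
      unfolding abs_mult[of "F _"]
      by (intro mult_mono C m_in_K[OF t K] ddir2_bound[OF t K]) auto
    ultimately show "\<bar>F1 (m (x + s *\<^sub>R v) t) * (ddir m v (x + s *\<^sub>R v) t)\<^sup>2
               + F (m (x + s *\<^sub>R v) t) * ddir2 m v (x + s *\<^sub>R v) t\<bar>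
        \<le> C1 * ((CARD('d) * norm v)\<^sup>2 * w2 t) + C * ((CARD('d) * norm v)\<^sup>2 * w2 t)"
      by linarith
  next
    show "integrable \<mu> (\<lambda>t. F (m (x + s *\<^sub>R v) t) * ddir m v (x + s *\<^sub>R v) t)" if "\<bar>s\<bar> < \<epsilon>" for s
      by (intro composite_mult_integrable[OF Fc \<epsilon>(2)[OF that]] ddir_integrable \<epsilon>(2) that)
    show "(\<lambda>t. F1 (m (x + 0 *\<^sub>R v) t) * (ddir m v (x + 0 *\<^sub>R v) t)\<^sup>2
               + F (m (x + 0 *\<^sub>R v) t) * ddir2 m v (x + 0 *\<^sub>R v) t) \<in> borel_measurable \<mu>"
      by (intro borel_measurable_add borel_measurable_times composite_measurable[OF F1 x0]
          composite_measurable[OF Fc x0] borel_measurable_power ddir_measurable ddir2_measurable x0)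
  qed (use w2_int in auto)
  moreover have "(LINT t|\<mu>. F1 (m x t) * (ddir m v x t)\<^sup>2 + F (m x t) * ddir2 m v x t) = I2 F F1 v x"
    unfolding I2_def
    using x0 by (intro Bochner_Integration.integral_add composite_mult_integrable[OF F1]
         composite_mult_integrable[OF Fc] ddir_square_integrable ddir2_integrable) auto
  ultimately show ?thesis unfolding I1_def by simp
qed

text \<open>The derivative of \<open>W\<close>: the two products of \<open>f1\<close> and
  \<open>g1\<close> cancel. Like \<open>W\<close>, it is a partial derivative of the determinant on
  the diagonal, now of second order.\<close>

abbreviation "W1 y \<equiv> f2 y * g y - f y * g2 y"

definition P_num :: "real ^ 'd \<Rightarrow> real ^ 'd \<Rightarrow> real" where
  "P_num v x = (I1 f1 v x * I0 g x - I0 f x * I1 g1 v x) * (g (M x))\<^sup>2"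

definition P_den :: "real ^ 'd \<Rightarrow> real" where
  "P_den x = (I0 g x)\<^sup>2 * W (M x)"

text \<open>The derivative of \<open>P_num v\<close> along \<open>v\<close>. The terms
  \<open>I1 f1 v x * I1 g1 v x\<close> from the two products cancel, and \<open>P v x\<close> enters
  as the derivative of \<open>M\<close>.\<close>

definition P_num1 :: "real ^ 'd \<Rightarrow> real ^ 'd \<Rightarrow> real" where
  "P_num1 v x = (I2 f1 f2 v x * I0 g x - I0 f x * I2 g1 g2 v x) * (g (M x))\<^sup>2
     + (I1 f1 v x * I0 g x - I0 f x * I1 g1 v x) * (2 * g (M x) * g1 (M x) * P v x)"

definition P_den1 :: "real ^ 'd \<Rightarrow> real ^ 'd \<Rightarrow> real" where
  "P_den1 v x = 2 * I0 g x * I1 g1 v x * W (M x) + (I0 g x)\<^sup>2 * (W1 (M x) * P v x)"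

definition Q :: "real ^ 'd \<Rightarrow> real ^ 'd \<Rightarrow> real" where
  "Q v x = (P_num1 v x * P_den x - P_num v x * P_den1 v x) / (P_den x * P_den x)"

lemma P_den_nonzero:
  assumes "x \<in> cube K"
  shows "P_den x \<noteq> 0"
  using I0_g_pos[OF assms] wronskian M_in_K[OF assms] \<delta>(2) unfolding P_den_def
  by (metis less_irrefl mult_eq_0_iff power_not_zero subsetD)

lemma P_derivative:
  assumes x: "x \<in> cube J"
  shows "((\<lambda>s. P v (x + s *\<^sub>R v)) has_real_derivative Q v x) (at 0)"
proof -
  have xK: "x \<in> cube K" using x by (rule cube_J_K)
  have MI: "M x \<in> I" using M_in_K[OF xK] \<delta>(2) by blast
  note M' = M_derivative[OF x, of v]
  have along: "((\<lambda>s. F (M (x + s *\<^sub>R v))) has_real_derivative F' * P v x) (at 0)"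
    if "(F has_real_derivative F') (at (M x))" for F F'
    using DERIV_chain2[where f = F and g = "\<lambda>s. M (x + s *\<^sub>R v)" and x = 0, OF _ M'] that by simp
  note comps = along[OF f_der[OF MI]] along[OF g_der[OF MI]] along[OF f1_der[OF MI]] along[OF g1_der[OF MI]]
    I0_f_derivative[OF x, of v] I0_g_derivative[OF x, of v]
    I1_derivative[OF f1_der f2_cont_K x, of v] I1_derivative[OF g1_der g2_cont_K x, of v]
  have num: "((\<lambda>s. P_num v (x + s *\<^sub>R v)) has_real_derivative P_num1 v x) (at 0)"
    unfolding P_num_def P_num1_def
    by (rule derivative_eq_intros comps refl | use \<delta>(2) in blast)+
       (simp add: power2_eq_square algebra_simps)
  have den: "((\<lambda>s. P_den (x + s *\<^sub>R v)) has_real_derivative P_den1 v x) (at 0)"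
    unfolding P_den_def P_den1_def
    by (rule derivative_eq_intros comps refl | use \<delta>(2) in blast)+
       (simp add: power2_eq_square algebra_simps)
  have "P v = (\<lambda>x. P_num v x / P_den x)" by (simp add: fun_eq_iff P_def P_num_def P_den_def)
  then show ?thesis
    using DERIV_divide[OF num den] P_den_nonzero[OF xK] unfolding Q_def by simp
qed

lemma M_tendsto:
  assumes X: "\<And>n. X n \<in> cube K" "X \<longlonglongrightarrow> diag x0"
  shows "(\<lambda>n. M (X n)) \<longlonglongrightarrow> x0"
proof (rule metric_tendsto_imp_tendsto[OF X(2)], rule always_eventually, rule allI)
  fix n
  have "x0 - norm (X n - diag x0) \<le> X n $ i \<and> X n $ i \<le> x0 + norm (X n - diag x0)" for i
    using component_le_norm_cart[of "X n - diag x0" i] by (auto simp: abs_le_iff)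
  then show "dist (M (X n)) x0 \<le> dist (X n) (diag x0)"
    using M_between[OF X(1)[of n], of "x0 - norm (X n - diag x0)" "x0 + norm (X n - diag x0)"]
    by (auto simp: dist_real_def dist_norm abs_le_iff)
qed

text \<open>\<open>Q\<close> is built by arithmetic from integrals and from functions of
  \<open>M\<close>. The integrands converge for each \<open>t\<close> by continuity of the partial
  derivatives, even though point and direction vary together, and dominated convergence gives the
  limits of the integrals.\<close>

lemma Q_tendsto:
  assumes X: "\<And>n. X n \<in> cube K" "X \<longlonglongrightarrow> diag x0" and V: "V \<longlonglongrightarrow> v"
  shows "(\<lambda>n. Q (V n) (X n)) \<longlonglongrightarrow> Q v (diag x0)"
proof -
  have x0K: "x0 \<in> K" "diag x0 \<in> cube K" using \<delta>(1) by auto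
  \<comment> \<open>A convergent sequence of directions is bounded; \<open>B\<close> makes the
    majorants independent of \<open>n\<close>.\<close>
  obtain B where B: "\<And>n. norm (V n) \<le> B"
    using convergent_imp_Bseq[of V] V unfolding convergent_def Bseq_def by blast
  have B0: "B \<ge> 0" using norm_ge_zero[of "V 0"] B[of 0] by linarith
  have fpdX: "(\<lambda>n. fpd i m (X n) t) \<longlonglongrightarrow> fpd i m (diag x0) t" if "t \<in> space \<mu>" for i t
  proof -
    have "continuous_on (cube I) (pd i (\<lambda>x. m x t))"
      using family that unfolding family_C1_def cont_partially_diff_def by blast
    from continuous_on_tendsto_compose[OF this X(2) cube_K_I[OF x0K(2)]] show ?thesis
      using cube_K_I[OF X(1)] unfolding fpd_def by simp
  qed
  have fpd2X: "(\<lambda>n. fpd j (fpd i m) (X n) t) \<longlonglongrightarrow> fpd j (fpd i m) (diag x0) t" if "t \<in> space \<mu>" for i j t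
  proof -
    have "continuous_on (cube I) (pd j (pd i (\<lambda>x. m x t)))"
      using family2 that unfolding family_C2_def twice_cont_partially_diff_def cont_partially_diff_def by blast
    from continuous_on_tendsto_compose[OF this X(2) cube_K_I[OF x0K(2)]] show ?thesis
      using cube_K_I[OF X(1)] unfolding fpd_def by simp
  qed
  have Vi: "(\<lambda>n. V n $ i) \<longlonglongrightarrow> v $ i" for i using V by (rule tendsto_vec_nth)
  have dX: "(\<lambda>n. ddir m (V n) (X n) t) \<longlonglongrightarrow> ddir m v (diag x0) t" if "t \<in> space \<mu>" for t
    unfolding ddir_def by (intro tendsto_intros Vi fpdX that)
  have d2X: "(\<lambda>n. ddir2 m (V n) (X n) t) \<longlonglongrightarrow> ddir2 m v (diag x0) t" if "t \<in> space \<mu>" for t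
    unfolding ddir2_def by (intro tendsto_intros Vi fpd2X that)
  have w0: "w t \<ge> 0" "w2 t \<ge> 0" if "t \<in> space \<mu>" for t
    using w_bound[OF that x0K(2)] w2_bound2[OF that x0K(2)] abs_ge_zero order_trans by blast+
  have sq: "(CARD('d) * norm (V n))\<^sup>2 \<le> (CARD('d) * B)\<^sup>2" for n
    using B by (intro power_mono mult_left_mono) auto
  have I0t: "(\<lambda>n. I0 F (X n)) \<longlonglongrightarrow> I0 F (diag x0)" if "continuous_on K F" for F
    unfolding I0_def using integral_tendsto[OF that X, of "\<lambda>_ _. 1" "\<lambda>_. 1" "\<lambda>_. 1"] by simp
  have I1t: "(\<lambda>n. I1 F (V n) (X n)) \<longlonglongrightarrow> I1 F v (diag x0)" if "continuous_on K F" for F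
    unfolding I1_def
  proof (rule integral_tendsto[OF that X, where u = "\<lambda>t. CARD('d) * B * w t"])
    show "\<bar>ddir m (V n) (X n) t\<bar> \<le> CARD('d) * B * w t" if "t \<in> space \<mu>" for n t
      by (rule order_trans[OF ddir_bound[OF that X(1)]]) (use B B0 w0[OF that] in \<open>auto intro!: mult_mono\<close>)
  qed (use ddir_measurable X(1) w_int dX in auto)
  have I2t: "(\<lambda>n. I2 F F1 (V n) (X n)) \<longlonglongrightarrow> I2 F F1 v (diag x0)"
    if "continuous_on K F" "continuous_on K F1" for F F1
    unfolding I2_def
  proof (rule tendsto_add)
    show "(\<lambda>n. LINT t|\<mu>. F1 (m (X n) t) * (ddir m (V n) (X n) t)\<^sup>2)
        \<longlonglongrightarrow> (LINT t|\<mu>. F1 (m (diag x0) t) * (ddir m v (diag x0) t)\<^sup>2)"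
    proof (rule integral_tendsto[OF that(2) X, where u = "\<lambda>t. (CARD('d) * B)\<^sup>2 * w2 t"])
      show "\<bar>(ddir m (V n) (X n) t)\<^sup>2\<bar> \<le> (CARD('d) * B)\<^sup>2 * w2 t" if "t \<in> space \<mu>" for n t
        by (rule order_trans[OF ddir_square_bound[OF that X(1)]]) (intro mult_right_mono sq w0 that)
    qed (use ddir_measurable X(1) w2_int dX in \<open>auto intro!: tendsto_power\<close>)
    show "(\<lambda>n. LINT t|\<mu>. F (m (X n) t) * ddir2 m (V n) (X n) t)
        \<longlonglongrightarrow> (LINT t|\<mu>. F (m (diag x0) t) * ddir2 m v (diag x0) t)"
    proof (rule integral_tendsto[OF that(1) X, where u = "\<lambda>t. (CARD('d) * B)\<^sup>2 * w2 t"])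
      show "\<bar>ddir2 m (V n) (X n) t\<bar> \<le> (CARD('d) * B)\<^sup>2 * w2 t" if "t \<in> space \<mu>" for n t
        by (rule order_trans[OF ddir2_bound[OF that X(1)]]) (intro mult_right_mono sq w0 that)
    qed (use ddir2_measurable X(1) w2_int d2X in auto)
  qed
  have FM: "(\<lambda>n. F (M (X n))) \<longlonglongrightarrow> F (M (diag x0))" if "continuous_on K F" for F :: "real \<Rightarrow> real"
    unfolding M_diag[OF x0K(1)]
    by (rule continuous_on_tendsto_compose[OF that M_tendsto[OF X] x0K(1)])
       (use M_in_K[OF X(1)] in auto)
  note lims = FM[OF f_cont] FM[OF g_cont] FM[OF f1_cont_K] FM[OF g1_cont_K] FM[OF f2_cont_K] FM[OF g2_cont_K]
    I0t[OF f_cont] I0t[OF g_cont] I1t[OF f1_cont_K] I1t[OF g1_cont_K]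
    I2t[OF f1_cont_K f2_cont_K] I2t[OF g1_cont_K g2_cont_K]
  have den: "(\<lambda>n. P_den (X n)) \<longlonglongrightarrow> P_den (diag x0)"
    unfolding P_den_def by (intro tendsto_intros lims)
  have num: "(\<lambda>n. P_num (V n) (X n)) \<longlonglongrightarrow> P_num v (diag x0)"
    unfolding P_num_def by (intro tendsto_intros lims)
  have Peq: "P v x = P_num v x / P_den x" for v x by (simp add: P_def P_num_def P_den_def)
  have P: "(\<lambda>n. P (V n) (X n)) \<longlonglongrightarrow> P v (diag x0)"
    unfolding Peq by (intro tendsto_divide num den P_den_nonzero x0K)
  have den1: "(\<lambda>n. P_den1 (V n) (X n)) \<longlonglongrightarrow> P_den1 v (diag x0)"
    unfolding P_den1_def by (intro tendsto_intros lims P)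
  have num1: "(\<lambda>n. P_num1 (V n) (X n)) \<longlonglongrightarrow> P_num1 v (diag x0)"
    unfolding P_num1_def by (intro tendsto_intros lims P)
  show ?thesis
    unfolding Q_def
    using P_den_nonzero[OF x0K(2)] by (intro tendsto_intros num den num1 den1) simp
qed

text \<open>In the quotient rule the terms with \<open>g1\<close> cancel and the powers of
  \<open>g\<close> drop out, so that only the ratio of \<open>W1\<close> and \<open>W\<close>
  remains of the generators. Its coefficient is the variance of the directional derivative of
  \<open>m\<close>.\<close>

lemma Q_diag:
  "Q v (diag x0) = W1 x0 / W x0 *
      ((LINT t|\<mu>. (ddir m v (diag x0) t)\<^sup>2) - (LINT t|\<mu>. ddir m v (diag x0) t)\<^sup>2)
     + (LINT t|\<mu>. ddir2 m v (diag x0) t)"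
proof -
  have x0K: "x0 \<in> K" using \<delta>(1) by auto
  have "W x0 \<noteq> 0" "g x0 > 0" using x0K \<delta>(2) wronskian g_pos by blast+
  define V G G1 where "V = W x0" and "G = g x0" and "G1 = g1 x0"
  define q a r where "q = (LINT t|\<mu>. (ddir m v (diag x0) t)\<^sup>2)" and "a = (LINT t|\<mu>. ddir m v (diag x0) t)"
    and "r = (LINT t|\<mu>. ddir2 m v (diag x0) t)"
  have den: "P_den (diag x0) = G\<^sup>2 * V"
    unfolding P_den_def by (simp add: I0_diag[OF x0K] M_diag[OF x0K] V_def G_def)
  have num: "P_num v (diag x0) = V * a * G\<^sup>2"
    unfolding P_num_def by (simp add: I0_diag[OF x0K] I1_diag[OF x0K] M_diag[OF x0K] V_def G_def a_def algebra_simps)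
  have den1: "P_den1 v (diag x0) = 2 * G * (G1 * a) * V + G\<^sup>2 * (W1 x0 * a)"
    unfolding P_den1_def
    by (simp add: I0_diag[OF x0K] I1_diag[OF x0K] M_diag[OF x0K] P_diag[OF x0K] V_def G_def G1_def a_def)
  have num1: "P_num1 v (diag x0) = (W1 x0 * q + V * r) * G\<^sup>2 + V * a * (2 * G * G1 * a)"
    unfolding P_num1_def
    by (simp add: I0_diag[OF x0K] I1_diag[OF x0K] I2_diag[OF x0K] M_diag[OF x0K] P_diag[OF x0K] V_def G_def G1_def a_def q_def r_def)
       (simp add: algebra_simps)
  have "V \<noteq> 0" "G \<noteq> 0" using \<open>W x0 \<noteq> 0\<close> \<open>g x0 > 0\<close> by (auto simp: V_def G_def)
  then have "Q v (diag x0) = W1 x0 / V * (q - a\<^sup>2) + r"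
    unfolding Q_def den num den1 num1 by (simp add: divide_simps) (simp add: power2_eq_square power4_eq_xxxx algebra_simps)
  then show ?thesis by (simp add: V_def q_def a_def r_def)
qed

end

text \<open>This plays the role of the Hessian of the mean at the diagonal point, over all d
  coordinates: its quadratic form is the second derivative along lines. The comparison matrix is a
  difference of two such arrays, restricted to the indices \<open>Some i\<close>.\<close>

definition mean_hessian ::
    "(real \<Rightarrow> real) \<Rightarrow> (real \<Rightarrow> real) \<Rightarrow> (real ^ 'd \<Rightarrow> 't \<Rightarrow> real) \<Rightarrow> 't measure \<Rightarrow> real \<Rightarrow> 'd \<Rightarrow> 'd \<Rightarrow> real"
  where
  "mean_hessian f g m \<mu> x0 i j =
     (bracket \<mu> (fpd i m) (fpd j m) (diag x0)
        - bracket \<mu> (fpd i m) one_fam (diag x0) * bracket \<mu> (fpd j m) one_fam (diag x0))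
       * (d1_cheb_det 2 f g x0 x0 / d1_cheb_det 1 f g x0 x0)
     + bracket \<mu> (fpd i (fpd j m)) one_fam (diag x0)"

section \<open>Integrals of directional derivatives as linear and quadratic forms in the
  direction\<close>

lemma (in local_mean_family) integral_ddir:
  "x \<in> cube K \<Longrightarrow> (LINT t|\<mu>. ddir m v x t) = (\<Sum>i\<in>UNIV. v $ i * bracket \<mu> (fpd i m) one_fam x)"
  unfolding ddir_def bracket_def using fpd_integrable by simp

context local_generated_mean_C2
begin

lemma fpd_mult_integrable:
  assumes x: "x \<in> cube K"
  shows "integrable \<mu> (\<lambda>t. fpd i m x t * fpd j m x t)"
proof (rule Bochner_Integration.integrable_bound[OF w2_int], rule borel_measurable_times, rule fpd_measurable[OF x], rule fpd_measurable[OF x], rule AE_I2)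
  fix t assume t: "t \<in> space \<mu>"
  have "2 * \<bar>fpd i m x t\<bar> * \<bar>fpd j m x t\<bar> \<le> \<bar>fpd i m x t\<bar>\<^sup>2 + \<bar>fpd j m x t\<bar>\<^sup>2"
    by (rule sum_squares_bound)
  then show "norm (fpd i m x t * fpd j m x t) \<le> norm (w2 t)"
    using w2_bound1[OF t x, of i] w2_bound1[OF t x, of j] by (simp add: abs_mult)
qed

lemma integral_ddir_square:
  assumes x: "x \<in> cube K"
  shows "(LINT t|\<mu>. (ddir m v x t)\<^sup>2) = (\<Sum>i\<in>UNIV. \<Sum>j\<in>UNIV. v $ i * v $ j * bracket \<mu> (fpd i m) (fpd j m) x)"
proof -
  have "(ddir m v x t)\<^sup>2 = (\<Sum>i\<in>UNIV. \<Sum>j\<in>UNIV. v $ i * v $ j * (fpd i m x t * fpd j m x t))" for t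
    unfolding ddir_def power2_eq_square sum_product by (intro sum.cong refl) (simp add: mult_ac)
  then show ?thesis
    unfolding bracket_def using fpd_mult_integrable[OF x] by simp
qed

lemma fpd2_integrable:
  assumes x: "x \<in> cube K"
  shows "integrable \<mu> (fpd j (fpd i m) x)"
proof (rule Bochner_Integration.integrable_bound[OF w2_int])
  show "fpd j (fpd i m) x \<in> borel_measurable \<mu>"
    using family2 cube_K_I[OF x] unfolding family_C2_def Lq_type_at_def by blast
  show "AE t in \<mu>. norm (fpd j (fpd i m) x t) \<le> norm (w2 t)"
    using w2_bound2[OF _ x, of _ j i] by (intro AE_I2) fastforce
qed

lemma integral_ddir2:
  assumes x: "x \<in> cube K"
  shows "(LINT t|\<mu>. ddir2 m v x t) = (\<Sum>i\<in>UNIV. \<Sum>j\<in>UNIV. v $ i * v $ j * bracket \<mu> (fpd i (fpd j m)) one_fam x)"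
proof -
  have "(LINT t|\<mu>. ddir2 m v x t)
      = (\<Sum>i\<in>UNIV. \<Sum>j\<in>UNIV. v $ i * v $ j * bracket \<mu> (fpd j (fpd i m)) one_fam x)"
    unfolding ddir2_def bracket_def using fpd2_integrable[OF x] by (simp add: sum_distrib_left mult.assoc)
  \<comment> \<open>The weight \<open>v $ i * v $ j\<close> is symmetric, so exchanging the names of
    the indices turns the order of differentiation of \<open>ddir2_def\<close> into that of
    \<open>mean_hessian_def\<close>.\<close>
  also have "\<dots> = (\<Sum>i\<in>UNIV. \<Sum>j\<in>UNIV. v $ i * v $ j * bracket \<mu> (fpd i (fpd j m)) one_fam x)"
    by (subst sum.swap) (simp add: mult.commute)
  finally show ?thesis .
qed

end

subsection \<open>Localisation and normalisation\<close>

lemma double_sum_quadratic_form: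
  fixes a :: "'d::finite \<Rightarrow> real"
  shows "c * ((\<Sum>i\<in>UNIV. \<Sum>j\<in>UNIV. v i * v j * q i j) - (\<Sum>i\<in>UNIV. v i * a i)\<^sup>2)
       + (\<Sum>i\<in>UNIV. \<Sum>j\<in>UNIV. v i * v j * r i j)
     = (\<Sum>i\<in>UNIV. \<Sum>j\<in>UNIV. v i * v j * ((q i j - a i * a j) * c + r i j))"
proof -
  have "(\<Sum>i\<in>UNIV. v i * a i)\<^sup>2 = (\<Sum>i\<in>UNIV. \<Sum>j\<in>UNIV. v i * v j * (a i * a j))"
    unfolding power2_eq_square sum_product by (intro sum.cong refl) (simp add: mult_ac)
  then show ?thesis
    by (simp add: sum_distrib_left sum_subtractf sum.distrib algebra_simps)
qed

text \<open>\<open>Lq_type_at\<close> supplies a radius and a majorant for each \<open>k\<close>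
  separately. Finitely many of them are merged by taking the smallest radius and the sum of the
  \<open>q\<close>-th powers of the majorants.\<close>

lemma dominated_near_diag:
  fixes \<phi> :: "'k::finite \<Rightarrow> real ^ 'd::finite \<Rightarrow> 't \<Rightarrow> real"
  assumes q: "q > 0" and "e > 0" and e: "{x0 - e..x0 + e} \<subseteq> I"
    and \<phi>: "\<And>k. Lq_type_at q I \<mu> (\<phi> k) (diag x0)"
  shows "\<exists>\<delta> w. 0 < \<delta> \<and> \<delta> \<le> e \<and> integrable \<mu> w \<and>
    (\<forall>t\<in>space \<mu>. \<forall>x\<in>cube {x0 - \<delta>..x0 + \<delta>}. \<forall>k. \<bar>\<phi> k x t\<bar> powr q \<le> w t)"
proof -
  obtain d a where d: "\<And>k. d k > 0" and a: "\<And>k. Lq_fun q \<mu> (a k)"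
    and bound: "\<And>k t x. t \<in> space \<mu> \<Longrightarrow> x \<in> cube I \<Longrightarrow> norm (x - diag x0) \<le> d k \<Longrightarrow> \<bar>\<phi> k x t\<bar> \<le> a k t"
    using \<phi> unfolding Lq_type_at_def by metis
  \<comment> \<open>A vector with entries of modulus at most \<open>\<delta>\<close> has norm at
    most \<open>CARD('d) * \<delta>\<close>; the bound by \<open>e\<close> keeps the cube inside
    that of \<open>I\<close>.\<close>
  define \<delta> where "\<delta> = min e (Min (range d) / CARD('d))"
  have "Min (range d) > 0" using d by simp
  then have \<delta>: "\<delta> > 0" "\<delta> \<le> e" and "\<delta> \<le> Min (range d) / CARD('d)"
    unfolding \<delta>_def using \<open>e > 0\<close> by simp_all
  then have \<delta>d: "CARD('d) * \<delta> \<le> Min (range d)"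
    by (simp add: pos_le_divide_eq mult.commute del: Min_ge_iff)
  have "\<bar>\<phi> k x t\<bar> powr q \<le> (\<Sum>k\<in>UNIV. \<bar>a k t\<bar> powr q)"
    if t: "t \<in> space \<mu>" and x: "x \<in> cube {x0 - \<delta>..x0 + \<delta>}" for t x k
  proof -
    have "norm (x - diag x0) \<le> (\<Sum>i\<in>UNIV. \<bar>(x - diag x0) $ i\<bar>)" by (rule norm_le_l1_cart)
    also have "\<dots> \<le> (\<Sum>i\<in>(UNIV::'d set). \<delta>)"
      using x by (intro sum_mono) (auto simp: cube_def abs_le_iff algebra_simps)
    also have "\<dots> \<le> Min (range d)" using \<delta>d by simp
    also have "\<dots> \<le> d k" by simp
    finally have "norm (x - diag x0) \<le> d k" .
    moreover have "x \<in> cube I"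
      by (rule cube_mono[OF x order_trans[OF _ e]]) (use \<delta>(2) in auto)
    ultimately have "\<bar>\<phi> k x t\<bar> \<le> a k t" by (intro bound[OF t])
    then have "\<bar>\<phi> k x t\<bar> powr q \<le> \<bar>a k t\<bar> powr q"
      using q by (intro powr_mono2) auto
    also have "\<dots> \<le> (\<Sum>k\<in>UNIV. \<bar>a k t\<bar> powr q)" by (rule member_le_sum) auto
    finally show ?thesis .
  qed
  moreover have "integrable \<mu> (\<lambda>t. \<Sum>k\<in>UNIV. \<bar>a k t\<bar> powr q)"
    using a unfolding Lq_fun_def by (intro Bochner_Integration.integrable_sum) blast
  ultimately show ?thesis using \<delta> by blast
qed

section \<open>Derivatives of the generators and of their determinant\<close>

lemma times_cont_diff_1:
  assumes "open I" "times_cont_diff 1 I f"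
  shows "x \<in> I \<Longrightarrow> (f has_real_derivative deriv f x) (at x)" "continuous_on I (deriv f)"
  using assms unfolding times_cont_diff_def
  by (auto simp: DERIV_deriv_iff_real_differentiable differentiable_on_eq_differentiable_at)

lemma times_cont_diff_2:
  assumes "times_cont_diff 2 I f"
  shows "times_cont_diff 1 I f" "times_cont_diff 1 I (deriv f)"
proof -
  have "\<forall>j<2. ((deriv ^^ j) f) differentiable_on I" and c: "continuous_on I ((deriv ^^ 2) f)"
    using assms unfolding times_cont_diff_def by auto
  from this(1)[rule_format, of 0] this(1)[rule_format, of 1]
  have "f differentiable_on I" "deriv f differentiable_on I" by simp_all
  with c show "times_cont_diff 1 I f" "times_cont_diff 1 I (deriv f)"
    unfolding times_cont_diff_def by (auto simp: numeral_2_eq_2 intro: differentiable_imp_continuous_on)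
qed

lemma deriv_cheb_det:
  assumes "open I" "x \<in> I" "times_cont_diff 1 I f" "times_cont_diff 1 I g"
  shows "deriv (\<lambda>s. cheb_det f g s y) x = deriv f x * g y - f y * deriv g x"
  unfolding cheb_det_def
  by (rule DERIV_imp_deriv)
     (use times_cont_diff_1(1)[OF assms(1,3,2)] times_cont_diff_1(1)[OF assms(1,4,2)] in
        \<open>auto intro!: derivative_eq_intros\<close>)

lemma d1_cheb_det_1:
  assumes "open I" "x \<in> I" "times_cont_diff 1 I f" "times_cont_diff 1 I g"
  shows "d1_cheb_det 1 f g x y = deriv f x * g y - f y * deriv g x"
  unfolding d1_cheb_det_def using deriv_cheb_det[OF assms] by simp

lemma d1_cheb_det_2:
  assumes "open I" "x \<in> I" and f: "times_cont_diff 2 I f" and g: "times_cont_diff 2 I g"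
  shows "d1_cheb_det 2 f g x y = deriv (deriv f) x * g y - f y * deriv (deriv g) x"
proof -
  \<comment> \<open>The outer derivative sees the inner one on a neighbourhood of \<open>x\<close>,
    so the formula is required there.\<close>
  have ev: "eventually (\<lambda>s. deriv (\<lambda>s. cheb_det f g s y) s = deriv f s * g y - f y * deriv g s) (nhds x)"
    using assms(1,2) deriv_cheb_det[OF assms(1) _ times_cont_diff_2(1)[OF f] times_cont_diff_2(1)[OF g]]
    unfolding eventually_nhds by blast
  have "d1_cheb_det 2 f g x y = deriv (deriv (\<lambda>s. cheb_det f g s y)) x"
    unfolding d1_cheb_det_def by (simp add: numeral_2_eq_2)
  also have "\<dots> = deriv (\<lambda>s. deriv f s * g y - f y * deriv g s) x"
    by (rule deriv_cong_ev[OF ev refl])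
  also have "\<dots> = deriv (deriv f) x * g y - f y * deriv (deriv g) x"
    by (rule DERIV_imp_deriv)
       (use times_cont_diff_1(1)[OF assms(1) times_cont_diff_2(2)[OF f] assms(2)]
            times_cont_diff_1(1)[OF assms(1) times_cont_diff_2(2)[OF g] assms(2)] in
          \<open>auto intro!: derivative_eq_intros\<close>)
  finally show ?thesis .
qed

lemma cheb_class_1:
  assumes "open I" "cheb_class 1 I f g"
  shows "times_cont_diff 1 I f" "times_cont_diff 1 I g"
    "x \<in> I \<Longrightarrow> y \<in> I \<Longrightarrow> x \<noteq> y \<Longrightarrow> cheb_det f g x y \<noteq> 0"
    "x \<in> I \<Longrightarrow> deriv f x * g x - f x * deriv g x \<noteq> 0"
proof -
  show tcd: "times_cont_diff 1 I f" "times_cont_diff 1 I g"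
    and "x \<in> I \<Longrightarrow> y \<in> I \<Longrightarrow> x \<noteq> y \<Longrightarrow> cheb_det f g x y \<noteq> 0"
    using assms(2) unfolding cheb_class_def chebyshev_system_def by blast+
  show "deriv f x * g x - f x * deriv g x \<noteq> 0" if "x \<in> I"
    using assms(2) d1_cheb_det_1[OF assms(1) that tcd, of x] that unfolding cheb_class_def by auto
qed

text \<open>
  Multiplying \<open>(f, g)\<close> by an invertible \<open>2 \<times> 2\<close>-matrix only rescales the determinant, hence does
  not change the mean; the matrix below makes the second function positive at \<open>z\<close>.
\<close>

lemma gen_mean_rotate:
  assumes "a\<^sup>2 + b\<^sup>2 \<noteq> (0::real)"
  shows "gen_mean (\<lambda>x. b * f x - a * g x) (\<lambda>x. a * f x + b * g x) m \<mu> = gen_mean f g m \<mu>"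
proof -
  have "cheb_det (\<lambda>x. b * f x - a * g x) (\<lambda>x. a * f x + b * g x) x y = (a\<^sup>2 + b\<^sup>2) * cheb_det f g x y" for x y
    unfolding cheb_det_def by (simp add: power2_eq_square algebra_simps)
  then have "(LINT t|\<mu>. cheb_det (\<lambda>x. b * f x - a * g x) (\<lambda>x. a * f x + b * g x) (m x t) y) = 0
      \<longleftrightarrow> (LINT t|\<mu>. cheb_det f g (m x t) y) = 0" for x y
    using assms by (simp only: integral_mult_right_zero) (metis mult_eq_0_iff)
  then show ?thesis unfolding gen_mean_def fun_eq_iff by simp
qed

text \<open>The linear change is chosen according to \<open>z\<close>: the new second function
  equals \<open>(f z)\<^sup>2 + (g z)\<^sup>2\<close> at \<open>z\<close> and stays positive nearby.
  Radius and majorant are left open below \<open>e\<close>, so that the first and the second order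
  theory can each choose their own.\<close>

lemma local_generated_mean_near:
  fixes m :: "real ^ 'd::finite \<Rightarrow> 't \<Rightarrow> real"
  assumes \<mu>: "prob_space \<mu>" and I: "open I" and fg: "cheb_class 1 I f g" and m: "family_C1 I \<mu> m" and z: "z \<in> I"
  shows "\<exists>e>0. {z - e..z + e} \<subseteq> I \<and> (\<forall>\<delta> w. 0 < \<delta> \<longrightarrow> \<delta> \<le> e \<longrightarrow> integrable \<mu> w \<longrightarrow>
    (\<forall>t\<in>space \<mu>. \<forall>x\<in>cube {z - \<delta>..z + \<delta>}. \<forall>i. \<bar>fpd i m x t\<bar> \<le> w t) \<longrightarrow>
    local_generated_mean \<mu> I m z \<delta> w
      (\<lambda>x. g z * f x - f z * g x) (\<lambda>x. f z * f x + g z * g x)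
      (\<lambda>x. g z * deriv f x - f z * deriv g x) (\<lambda>x. f z * deriv f x + g z * deriv g x))"
    and "(f z)\<^sup>2 + (g z)\<^sup>2 \<noteq> 0"
proof -
  note c = cheb_class_1[OF I fg]
  note f = times_cont_diff_1[OF I c(1)] and g = times_cont_diff_1[OF I c(2)]
  \<comment> \<open>If both generators vanished at \<open>z\<close>, so would the Wronskian.\<close>
  show nz: "(f z)\<^sup>2 + (g z)\<^sup>2 \<noteq> 0" using c(4)[OF z] by (auto simp: sum_power2_eq_zero_iff)
  let ?G = "\<lambda>x. f z * f x + g z * g x"
  have "isCont ?G z"
    by (rule DERIV_isCont[OF DERIV_add[OF DERIV_cmult[OF f(1)[OF z]] DERIV_cmult[OF g(1)[OF z]]]])
  moreover have "?G z > 0" using nz by (simp add: power2_eq_square[symmetric] less_le)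
  ultimately have "\<forall>\<^sub>F y in nhds z. ?G y > 0"
    by (rule order_tendstoD(1)[OF tendsto_at_iff_tendsto_nhds[of ?G z, THEN iffD1, OF isContD]])
  moreover have "\<forall>\<^sub>F y in nhds z. y \<in> I" using I z eventually_nhds by blast
  ultimately have "\<forall>\<^sub>F y in nhds z. y \<in> I \<and> ?G y > 0" by eventually_elim simp
  then obtain d where "d > 0" and d: "\<And>y. \<bar>y - z\<bar> < d \<Longrightarrow> y \<in> I \<and> ?G y > 0"
    unfolding eventually_nhds_metric dist_real_def by blast
  have *: "y \<in> I \<and> ?G y > 0" if "\<delta> \<le> d / 2" "y \<in> {z - \<delta>..z + \<delta>}" for \<delta> y
    using that \<open>d > 0\<close> by (intro d) (auto simp: abs_less_iff)
  show "\<exists>e>0. {z - e..z + e} \<subseteq> I \<and> (\<forall>\<delta> w. 0 < \<delta> \<longrightarrow> \<delta> \<le> e \<longrightarrow> integrable \<mu> w \<longrightarrow>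
    (\<forall>t\<in>space \<mu>. \<forall>x\<in>cube {z - \<delta>..z + \<delta>}. \<forall>i. \<bar>fpd i m x t\<bar> \<le> w t) \<longrightarrow>
    local_generated_mean \<mu> I m z \<delta> w
      (\<lambda>x. g z * f x - f z * g x) ?G
      (\<lambda>x. g z * deriv f x - f z * deriv g x) (\<lambda>x. f z * deriv f x + g z * deriv g x))"
  proof (intro exI[of _ "d / 2"] conjI allI impI)
    show "d / 2 > 0" using \<open>d > 0\<close> by simp
    show "{z - d / 2..z + d / 2} \<subseteq> I" using * by blast
    fix \<delta> w assume \<delta>: "0 < \<delta>" "\<delta> \<le> d / 2" and w: "integrable \<mu> w"
      "\<forall>t\<in>space \<mu>. \<forall>x\<in>cube {z - \<delta>..z + \<delta>}. \<forall>i. \<bar>fpd i m x t\<bar> \<le> w t"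
    interpret prob_space \<mu> by fact
    show "local_generated_mean \<mu> I m z \<delta> w
      (\<lambda>x. g z * f x - f z * g x) ?G
      (\<lambda>x. g z * deriv f x - f z * deriv g x) (\<lambda>x. f z * deriv f x + g z * deriv g x)"
    proof unfold_locales
      show "{z - \<delta>..z + \<delta>} \<subseteq> I" using *[OF \<delta>(2)] by blast
      show "?G y > 0" if "y \<in> {z - \<delta>..z + \<delta>}" for y using *[OF \<delta>(2) that] by blast
      show "((\<lambda>x. g z * f x - f z * g x) has_real_derivative g z * deriv f y - f z * deriv g y) (at y)"
        "(?G has_real_derivative f z * deriv f y + g z * deriv g y) (at y)" if "y \<in> I" for y
        by (intro DERIV_diff DERIV_add DERIV_cmult f g that)+
      show "continuous_on I (\<lambda>x. g z * deriv f x - f z * deriv g x)"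
        "continuous_on I (\<lambda>x. f z * deriv f x + g z * deriv g x)"
        by (intro continuous_intros f g)+
      show "cheb_det (\<lambda>x. g z * f x - f z * g x) ?G y y' \<noteq> 0" if "y \<in> I" "y' \<in> I" "y \<noteq> y'" for y y'
      proof -
        have "cheb_det (\<lambda>x. g z * f x - f z * g x) ?G y y' = ((f z)\<^sup>2 + (g z)\<^sup>2) * cheb_det f g y y'"
          unfolding cheb_det_def by (simp add: power2_eq_square algebra_simps)
        then show ?thesis using nz c(3)[OF that] by simp
      qed
      show "(g z * deriv f y - f z * deriv g y) * ?G y
          - (g z * f y - f z * g y) * (f z * deriv f y + g z * deriv g y) \<noteq> 0" if "y \<in> I" for y
      proof -
        \<comment> \<open>As for \<open>cheb_det\<close> above, this is the multiplicativity of 2 by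
          2 determinants; the factor is the determinant of the linear change.\<close>
        have "(g z * deriv f y - f z * deriv g y) * ?G y
          - (g z * f y - f z * g y) * (f z * deriv f y + g z * deriv g y)
          = ((f z)\<^sup>2 + (g z)\<^sup>2) * (deriv f y * g y - f y * deriv g y)"
          by (simp add: power2_eq_square algebra_simps)
        then show ?thesis using nz c(4)[OF that] by (metis mult_eq_0_iff)
      qed
    qed (use I m \<delta> w in auto)
  qed
qed

text \<open>The localisation is centred at \<open>z\<close> itself, so the formulas are available at
  every diagonal point and are stated in terms of the original generators.\<close>

lemma gen_mean_diag_derivative:
  fixes m :: "real ^ 'd::finite \<Rightarrow> 't \<Rightarrow> real"
  assumes "prob_space \<mu>" "open I" "cheb_class 1 I f g" and m: "family_C1 I \<mu> m" and z: "z \<in> I"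
  shows "gen_mean f g m \<mu> (diag z) = z"
    and "((\<lambda>s. gen_mean f g m \<mu> (diag z + s *\<^sub>R v)) has_real_derivative
       (\<Sum>i\<in>UNIV. v $ i * bracket \<mu> (fpd i m) one_fam (diag z))) (at 0)"
proof -
  note near = local_generated_mean_near[OF assms]
  obtain e where "e > 0" "{z - e..z + e} \<subseteq> I" and e: "\<And>\<delta> w. 0 < \<delta> \<Longrightarrow> \<delta> \<le> e \<Longrightarrow> integrable \<mu> w \<Longrightarrow>
    (\<forall>t\<in>space \<mu>. \<forall>x\<in>cube {z - \<delta>..z + \<delta>}. \<forall>i. \<bar>fpd i m x t\<bar> \<le> w t) \<Longrightarrow>
    local_generated_mean \<mu> I m z \<delta> w
      (\<lambda>x. g z * f x - f z * g x) (\<lambda>x. f z * f x + g z * g x)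
      (\<lambda>x. g z * deriv f x - f z * deriv g x) (\<lambda>x. f z * deriv f x + g z * deriv g x)"
    using near(1) by blast
  have "Lq_type_at 1 I \<mu> (fpd i m) (diag z)" for i
    using m z unfolding family_C1_def by simp
  from dominated_near_diag[where \<phi> = "\<lambda>i. fpd i m", OF zero_less_one \<open>e > 0\<close> \<open>{z - e..z + e} \<subseteq> I\<close> this]
  obtain \<delta> w where "0 < \<delta>" "\<delta> \<le> e" "integrable \<mu> w"
    "\<forall>t\<in>space \<mu>. \<forall>x\<in>cube {z - \<delta>..z + \<delta>}. \<forall>i. \<bar>fpd i m x t\<bar> \<le> w t" by auto
  then interpret L: local_generated_mean \<mu> I m z \<delta> w
      "\<lambda>x. g z * f x - f z * g x" "\<lambda>x. f z * f x + g z * g x"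
      "\<lambda>x. g z * deriv f x - f z * deriv g x" "\<lambda>x. f z * deriv f x + g z * deriv g x"
    by (rule e)
  note eq = gen_mean_rotate[OF near(2), of f g m \<mu>]
  have zK: "z \<in> {z - \<delta>..z + \<delta>}" "diag z \<in> cube {z - \<delta>..z + \<delta>}" "diag z \<in> cube {z - \<delta><..<z + \<delta>}"
    using \<open>0 < \<delta>\<close> by auto
  show "gen_mean f g m \<mu> (diag z) = z" using L.M_diag[OF zK(1)] unfolding eq .
  show "((\<lambda>s. gen_mean f g m \<mu> (diag z + s *\<^sub>R v)) has_real_derivative
       (\<Sum>i\<in>UNIV. v $ i * bracket \<mu> (fpd i m) one_fam (diag z))) (at 0)"
    using L.M_derivative[OF zK(3), of v] unfolding eq L.P_diag[OF zK(1)] L.integral_ddir[OF zK(2)] .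
qed

text \<open>
  Continuity of \<open>Q\<close> is required only at the diagonal point, but jointly with the direction: this gives
  a sign of \<open>Q\<close> that is uniform over the compact unit sphere of directions.
\<close>

definition directional_C2 ::
    "real \<Rightarrow> real \<Rightarrow> (real ^ 'd \<Rightarrow> real) \<Rightarrow> (real ^ 'd \<Rightarrow> real ^ 'd \<Rightarrow> real) \<Rightarrow>
     (real ^ 'd \<Rightarrow> real ^ 'd \<Rightarrow> real) \<Rightarrow> bool" where
  "directional_C2 z \<delta> M P Q \<longleftrightarrow> \<delta> > 0 \<and>
     (\<forall>x \<in> cube {z - \<delta><..<z + \<delta>}. \<forall>v.
        ((\<lambda>s. M (x + s *\<^sub>R v)) has_real_derivative P v x) (at 0) \<and>
        ((\<lambda>s. P v (x + s *\<^sub>R v)) has_real_derivative Q v x) (at 0)) \<and>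
     (\<forall>X V v. (\<forall>n. X n \<in> cube {z - \<delta><..<z + \<delta>}) \<longrightarrow> X \<longlonglongrightarrow> diag z \<longrightarrow> V \<longlonglongrightarrow> v \<longrightarrow>
        (\<lambda>n. Q (V n) (X n)) \<longlonglongrightarrow> Q v (diag z))"

lemma directional_C2D:
  fixes M :: "real ^ 'd::finite \<Rightarrow> real"
  assumes "directional_C2 z \<delta> M P Q"
  shows "\<delta> > 0"
    and "x + s *\<^sub>R v \<in> cube {z - \<delta><..<z + \<delta>} \<Longrightarrow>
      ((\<lambda>s. M (x + s *\<^sub>R v)) has_real_derivative P v (x + s *\<^sub>R v)) (at s)"
    and "x + s *\<^sub>R v \<in> cube {z - \<delta><..<z + \<delta>} \<Longrightarrow>
      ((\<lambda>s. P v (x + s *\<^sub>R v)) has_real_derivative Q v (x + s *\<^sub>R v)) (at s)"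
    and "(\<And>n. X n \<in> cube {z - \<delta><..<z + \<delta>}) \<Longrightarrow> X \<longlonglongrightarrow> diag z \<Longrightarrow> V \<longlonglongrightarrow> v \<Longrightarrow>
      (\<lambda>n. Q (V n) (X n)) \<longlonglongrightarrow> Q v (diag z)"
  using assms unfolding directional_C2_def by (blast intro: has_real_derivative_line_shift)+

text \<open>The two means to be compared come with different linear changes and different majorants.
  \<open>directional_C2\<close> detaches the result from these choices, so that the comparison only
  handles the derivatives \<open>P\<close> and \<open>Q\<close>.\<close>

lemma gen_mean_second_order:
  fixes m :: "real ^ 'd::finite \<Rightarrow> 't \<Rightarrow> real"
  assumes \<mu>: "prob_space \<mu>" and I: "open I" and fg1: "cheb_class 1 I f g" and fg: "cheb_class 2 I f g"
    and m: "family_C2 I \<mu> m" and z: "z \<in> I"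
  obtains \<delta> P Q where "directional_C2 z \<delta> (gen_mean f g m \<mu>) P Q"
    and "\<And>v. Q v (diag z) = (\<Sum>i\<in>UNIV. \<Sum>j\<in>UNIV. v $ i * v $ j * mean_hessian f g m \<mu> z i j)"
proof -
  have m1: "family_C1 I \<mu> m" using m unfolding family_C2_def by blast
  note near = local_generated_mean_near[OF \<mu> I fg1 m1 z]
  obtain e where "e > 0" "{z - e..z + e} \<subseteq> I" and e: "\<And>\<delta> w. 0 < \<delta> \<Longrightarrow> \<delta> \<le> e \<Longrightarrow> integrable \<mu> w \<Longrightarrow>
    (\<forall>t\<in>space \<mu>. \<forall>x\<in>cube {z - \<delta>..z + \<delta>}. \<forall>i. \<bar>fpd i m x t\<bar> \<le> w t) \<Longrightarrow>
    local_generated_mean \<mu> I m z \<delta> w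
      (\<lambda>x. g z * f x - f z * g x) (\<lambda>x. f z * f x + g z * g x)
      (\<lambda>x. g z * deriv f x - f z * deriv g x) (\<lambda>x. f z * deriv f x + g z * deriv g x)"
    using near(1) by blast
  note e_sub = \<open>{z - e..z + e} \<subseteq> I\<close>
  have L: "Lq_type_at 1 I \<mu> (fpd i m) (diag z)" "Lq_type_at 2 I \<mu> (fpd i m) (diag z)"
    "Lq_type_at 1 I \<mu> (fpd i (fpd j m)) (diag z)" for i j
    using m m1 z unfolding family_C1_def family_C2_def by simp_all
  obtain \<delta>1 w1 where 1: "0 < \<delta>1" "\<delta>1 \<le> e" "integrable \<mu> w1"
    "\<forall>t\<in>space \<mu>. \<forall>x\<in>cube {z - \<delta>1..z + \<delta>1}. \<forall>i. \<bar>fpd i m x t\<bar> \<le> w1 t"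
    using dominated_near_diag[where \<phi> = "\<lambda>i. fpd i m", OF zero_less_one \<open>e > 0\<close> e_sub L(1)] by auto
  obtain \<delta>2 w2 where 2: "0 < \<delta>2" "\<delta>2 \<le> e" "integrable \<mu> w2"
    "\<forall>t\<in>space \<mu>. \<forall>x\<in>cube {z - \<delta>2..z + \<delta>2}. \<forall>i. \<bar>fpd i m x t\<bar> powr 2 \<le> w2 t"
    using dominated_near_diag[where \<phi> = "\<lambda>i. fpd i m", OF zero_less_numeral \<open>e > 0\<close> e_sub L(2)] by auto
  \<comment> \<open>Pairs of indices form a finite type, so \<open>dominated_near_diag\<close>
    treats all second derivatives at once.\<close>
  have "Lq_type_at 1 I \<mu> ((\<lambda>(i, j). fpd i (fpd j m)) k) (diag z)" for k
    using L(3) by (cases k) simp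
  from dominated_near_diag[where \<phi> = "\<lambda>k. (\<lambda>(i, j). fpd i (fpd j m)) k", OF zero_less_one \<open>e > 0\<close> e_sub this]
  obtain \<delta>3 w3 where 3: "0 < \<delta>3" "\<delta>3 \<le> e" "integrable \<mu> w3"
    "\<forall>t\<in>space \<mu>. \<forall>x\<in>cube {z - \<delta>3..z + \<delta>3}. \<forall>i j. \<bar>fpd i (fpd j m) x t\<bar> \<le> w3 t" by auto
  define \<delta> where "\<delta> = min \<delta>1 (min \<delta>2 \<delta>3)"
  have \<delta>: "\<delta> > 0" "\<delta> \<le> e" using 1 2 3 by (auto simp: \<delta>_def)
  have sub: "x \<in> cube {z - \<delta>1..z + \<delta>1}" "x \<in> cube {z - \<delta>2..z + \<delta>2}" "x \<in> cube {z - \<delta>3..z + \<delta>3}"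
    if "x \<in> cube {z - \<delta>..z + \<delta>}" for x :: "real ^ 'd"
    by (rule cube_mono[OF that]; auto simp: \<delta>_def)+
  have loc: "local_generated_mean \<mu> I m z \<delta> w1
      (\<lambda>x. g z * f x - f z * g x) (\<lambda>x. f z * f x + g z * g x)
      (\<lambda>x. g z * deriv f x - f z * deriv g x) (\<lambda>x. f z * deriv f x + g z * deriv g x)"
    using 1 sub by (intro e[OF \<delta>]) auto
  have tcd: "times_cont_diff 2 I f" "times_cont_diff 2 I g" using fg unfolding cheb_class_def by auto
  note f = times_cont_diff_1[OF I times_cont_diff_2(2)[OF tcd(1)]]
   and g = times_cont_diff_1[OF I times_cont_diff_2(2)[OF tcd(2)]]
  interpret L: local_generated_mean_C2 \<mu> I m z \<delta> w1
      "\<lambda>x. g z * f x - f z * g x" "\<lambda>x. f z * f x + g z * g x"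
      "\<lambda>x. g z * deriv f x - f z * deriv g x" "\<lambda>x. f z * deriv f x + g z * deriv g x"
      "\<lambda>x. g z * deriv (deriv f) x - f z * deriv (deriv g) x"
      "\<lambda>x. f z * deriv (deriv f) x + g z * deriv (deriv g) x" "\<lambda>t. w2 t + w3 t"
  proof (rule local_generated_mean_C2.intro[OF loc], unfold_locales)
    show "((\<lambda>x. g z * deriv f x - f z * deriv g x) has_real_derivative
          g z * deriv (deriv f) y - f z * deriv (deriv g) y) (at y)"
      "((\<lambda>x. f z * deriv f x + g z * deriv g x) has_real_derivative
          f z * deriv (deriv f) y + g z * deriv (deriv g) y) (at y)" if "y \<in> I" for y
      by (intro DERIV_diff DERIV_add DERIV_cmult f g that)+
    show "continuous_on I (\<lambda>x. g z * deriv (deriv f) x - f z * deriv (deriv g) x)"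
      "continuous_on I (\<lambda>x. f z * deriv (deriv f) x + g z * deriv (deriv g) x)"
      by (intro continuous_intros f g)+
    show "integrable \<mu> (\<lambda>t. w2 t + w3 t)" using 2 3 by simp
    fix t and x :: "real ^ 'd" assume tx: "t \<in> space \<mu>" "x \<in> cube {z - \<delta>..z + \<delta>}"
    have b2: "(fpd i m x t)\<^sup>2 \<le> w2 t" for i
    proof -
      have "\<bar>fpd i m x t\<bar> powr 2 \<le> w2 t" using 2(4) tx(1) sub(2)[OF tx(2)] by blast
      then show ?thesis by simp
    qed
    have b3: "\<bar>fpd i (fpd j m) x t\<bar> \<le> w3 t" for i j
      using 3(4) tx(1) sub(3)[OF tx(2)] by blast
    have "w2 t \<ge> 0" "w3 t \<ge> 0"
      using order_trans[OF zero_le_power2 b2] order_trans[OF abs_ge_zero b3] by auto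
    then show "(fpd i m x t)\<^sup>2 \<le> w2 t + w3 t" "\<bar>fpd j (fpd i m) x t\<bar> \<le> w2 t + w3 t" for i j
      using b2[of i] b3[of j i] by linarith+
  qed (rule m)
  note eq = gen_mean_rotate[OF near(2), of f g m \<mu>]
  have zK: "diag z \<in> cube {z - \<delta>..z + \<delta>}" using \<delta> by auto
  \<comment> \<open>The linear change multiplies \<open>W\<close> and \<open>W1\<close> by the same
    factor, so their quotient is the one formed with the original generators.\<close>
  have W: "(g z * deriv f z - f z * deriv g z) * (f z * f z + g z * g z)
       - (g z * f z - f z * g z) * (f z * deriv f z + g z * deriv g z)
     = ((f z)\<^sup>2 + (g z)\<^sup>2) * d1_cheb_det 1 f g z z"
    unfolding d1_cheb_det_1[OF I z times_cont_diff_2(1)[OF tcd(1)] times_cont_diff_2(1)[OF tcd(2)]]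
    by (simp add: power2_eq_square algebra_simps)
  have W1: "(g z * deriv (deriv f) z - f z * deriv (deriv g) z) * (f z * f z + g z * g z)
       - (g z * f z - f z * g z) * (f z * deriv (deriv f) z + g z * deriv (deriv g) z)
     = ((f z)\<^sup>2 + (g z)\<^sup>2) * d1_cheb_det 2 f g z z"
    unfolding d1_cheb_det_2[OF I z tcd] by (simp add: power2_eq_square algebra_simps)
  have Q: "L.Q v (diag z) = (\<Sum>i\<in>UNIV. \<Sum>j\<in>UNIV. v $ i * v $ j * mean_hessian f g m \<mu> z i j)" for v
    unfolding L.Q_diag W W1 mult_divide_mult_cancel_left[OF near(2)]
      L.integral_ddir[OF zK] L.integral_ddir_square[OF zK] L.integral_ddir2[OF zK]
      double_sum_quadratic_form mean_hessian_def ..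
  have "directional_C2 z \<delta> (gen_mean f g m \<mu>) L.P L.Q"
    unfolding directional_C2_def
  proof (intro conjI ballI allI impI)
    show "((\<lambda>s. gen_mean f g m \<mu> (x + s *\<^sub>R v)) has_real_derivative L.P v x) (at 0)"
      if "x \<in> cube {z - \<delta><..<z + \<delta>}" for x v
      using L.M_derivative[OF that, of v] unfolding eq .
    show "(\<lambda>n. L.Q (V n) (X n)) \<longlonglongrightarrow> L.Q v (diag z)"
      if "\<forall>n. X n \<in> cube {z - \<delta><..<z + \<delta>}" "X \<longlonglongrightarrow> diag z" "V \<longlonglongrightarrow> v" for X V v
      using L.Q_tendsto[OF L.cube_J_K that(2,3)] that(1) by blast
  qed (use \<delta> L.P_derivative in auto)
  then show ?thesis using Q by (rule that)
qed

subsection \<open>Comparison of two means\<close>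

lemma mean_hessian_commute:
  fixes m :: "real ^ 'd::finite \<Rightarrow> 't \<Rightarrow> real"
  assumes "open I" and m: "family_C2 I \<mu> m" and z: "z \<in> I"
  shows "mean_hessian f g m \<mu> z i j = mean_hessian f g m \<mu> z j i"
proof -
  have "fpd i (fpd j m) (diag z) t = fpd j (fpd i m) (diag z) t" if "t \<in> space \<mu>" for t
    using pd_pd_symmetric[OF \<open>open I\<close>, of "\<lambda>x. m x t" "diag z" i j] m z that
    unfolding family_C2_def fpd_def by simp
  then have "bracket \<mu> (fpd i (fpd j m)) one_fam (diag z) = bracket \<mu> (fpd j (fpd i m)) one_fam (diag z)"
    unfolding bracket_def by (intro Bochner_Integration.integral_cong) auto
  then show ?thesis unfolding mean_hessian_def by (simp add: bracket_def mult.commute)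
qed

text \<open>These are the directions that keep the last coordinate fixed. On them the quadratic form
  of the d by d array \<open>mean_hessian\<close> involves the indices \<open>Some i\<close>
  only.\<close>

definition extend_zero :: "real ^ 'n \<Rightarrow> real ^ 'n option" where
  "extend_zero v = (\<chi> i. case i of None \<Rightarrow> 0 | Some j \<Rightarrow> v $ j)"

lemma extend_zero_nth [simp]: "extend_zero v $ None = 0" "extend_zero v $ Some j = v $ j"
  by (simp_all add: extend_zero_def)

lemma sum_option_UNIV:
  fixes F :: "'n::finite option \<Rightarrow> real"
  shows "(\<Sum>i\<in>UNIV. F i) = F None + (\<Sum>j\<in>UNIV. F (Some j))"
  unfolding UNIV_option_conv by (simp add: sum.reindex)

lemma comparison_matrix_nth:
  "comparison_matrix f g m \<mu> h k n \<nu> x0 $ i $ j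
     = mean_hessian h k n \<nu> x0 (Some i) (Some j) - mean_hessian f g m \<mu> x0 (Some i) (Some j)"
  unfolding comparison_matrix_def mean_hessian_def by simp

lemma comparison_matrix_quadratic_form:
  fixes v :: "real ^ 'n::finite"
  shows "(\<Sum>i\<in>UNIV. \<Sum>j\<in>UNIV. extend_zero v $ i * extend_zero v $ j * mean_hessian h k n \<nu> x0 i j)
     - (\<Sum>i\<in>UNIV. \<Sum>j\<in>UNIV. extend_zero v $ i * extend_zero v $ j * mean_hessian f g m \<mu> x0 i j)
     = v \<bullet> (comparison_matrix f g m \<mu> h k n \<nu> x0 *v v)"
  unfolding inner_vec_def matrix_vector_mult_def comparison_matrix_nth
  by (simp add: sum_option_UNIV sum_distrib_left sum_subtractf[symmetric] algebra_simps)

lemma transpose_comparison_matrix: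
  fixes m :: "real ^ 'n::finite option \<Rightarrow> 't \<Rightarrow> real" and n :: "real ^ 'n option \<Rightarrow> 's \<Rightarrow> real"
  assumes "open I" "family_C2 I \<mu> m" "family_C2 I \<nu> n" "x0 \<in> I"
  shows "transpose (comparison_matrix f g m \<mu> h k n \<nu> x0) = comparison_matrix f g m \<mu> h k n \<nu> x0"
proof -
  have "comparison_matrix f g m \<mu> h k n \<nu> x0 $ j $ i = comparison_matrix f g m \<mu> h k n \<nu> x0 $ i $ j" for i j
    unfolding comparison_matrix_nth
      mean_hessian_commute[OF assms(1,2,4), of _ _ "Some j"] mean_hessian_commute[OF assms(1,3,4), of _ _ "Some j"] ..
  then show ?thesis unfolding transpose_def vec_eq_iff by simp
qed

text \<open>At every diagonal point over \<open>U\<close>, and not just at \<open>x0\<close>, the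
  nonnegative difference of the means attains the value 0. Its derivative along each axis therefore
  vanishes throughout \<open>U\<close>.\<close>

lemma first_order_condition:
  fixes m :: "real ^ 'd::finite \<Rightarrow> 't \<Rightarrow> real" and n :: "real ^ 'd \<Rightarrow> 's \<Rightarrow> real"
  assumes I: "open I" and \<mu>: "prob_space \<mu>" and \<nu>: "prob_space \<nu>"
    and fg: "cheb_class 1 I f g" and hk: "cheb_class 1 I h k"
    and m: "family_C1 I \<mu> m" and n: "family_C1 I \<nu> n"
    and U: "open U" "U \<subseteq> I" and le: "\<And>x. x \<in> cube U \<Longrightarrow> gen_mean f g m \<mu> x \<le> gen_mean h k n \<nu> x"
    and x: "x \<in> U"
  shows "bracket \<mu> (fpd i m) one_fam (diag x) = bracket \<nu> (fpd i n) one_fam (diag x)"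
proof -
  have xI: "x \<in> I" using x U by blast
  note M = gen_mean_diag_derivative[OF \<mu> I fg m xI] and N = gen_mean_diag_derivative[OF \<nu> I hk n xI]
  obtain \<epsilon> where \<epsilon>: "\<epsilon> > 0" "\<And>s. \<bar>s\<bar> < \<epsilon> \<Longrightarrow> diag x + s *\<^sub>R axis i 1 \<in> cube U"
    using line_in_open[OF open_cube[OF U(1)], of "diag x" "axis i 1"] x by auto
  have ax: "(\<Sum>j\<in>UNIV. axis i 1 $ j * c j) = (c i :: real)" for c
    by (simp add: axis_def if_distrib[of "\<lambda>a. a * _"] sum.delta cong: if_cong)
  have "bracket \<nu> (fpd i n) one_fam (diag x) - bracket \<mu> (fpd i m) one_fam (diag x) = 0"
  proof (rule DERIV_local_min[OF _ \<epsilon>(1)])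
    show "((\<lambda>s. gen_mean h k n \<nu> (diag x + s *\<^sub>R axis i 1) - gen_mean f g m \<mu> (diag x + s *\<^sub>R axis i 1))
      has_real_derivative bracket \<nu> (fpd i n) one_fam (diag x) - bracket \<mu> (fpd i m) one_fam (diag x)) (at 0)"
      using DERIV_diff[OF N(2) M(2), of "axis i 1" "axis i 1"] unfolding ax .
    show "\<forall>s. \<bar>0 - s\<bar> < \<epsilon> \<longrightarrow>
        gen_mean h k n \<nu> (diag x + 0 *\<^sub>R axis i 1) - gen_mean f g m \<mu> (diag x + 0 *\<^sub>R axis i 1)
        \<le> gen_mean h k n \<nu> (diag x + s *\<^sub>R axis i 1) - gen_mean f g m \<mu> (diag x + s *\<^sub>R axis i 1)"
      using le[OF \<epsilon>(2)] M(1) N(1) by simp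
  qed
  then show ?thesis by simp
qed

lemma second_order_condition:
  fixes m :: "real ^ 'n::finite option \<Rightarrow> 't \<Rightarrow> real" and n :: "real ^ 'n option \<Rightarrow> 's \<Rightarrow> real"
  assumes I: "open I" and \<mu>: "prob_space \<mu>" and \<nu>: "prob_space \<nu>"
    and fg1: "cheb_class 1 I f g" and hk1: "cheb_class 1 I h k"
    and fg: "cheb_class 2 I f g" and hk: "cheb_class 2 I h k"
    and m: "family_C2 I \<mu> m" and n: "family_C2 I \<nu> n"
    and U: "open U" "x0 \<in> U" "U \<subseteq> I"
    and le: "\<And>x. x \<in> cube U \<Longrightarrow> gen_mean f g m \<mu> x \<le> gen_mean h k n \<nu> x"
  shows "0 \<le> v \<bullet> (comparison_matrix f g m \<mu> h k n \<nu> x0 *v v)"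
proof -
  have x0: "x0 \<in> I" using U by blast
  obtain \<delta>M PM QM where cM: "directional_C2 x0 \<delta>M (gen_mean f g m \<mu>) PM QM"
    and QM: "\<And>v. QM v (diag x0) = (\<Sum>i\<in>UNIV. \<Sum>j\<in>UNIV. v $ i * v $ j * mean_hessian f g m \<mu> x0 i j)"
    using gen_mean_second_order[OF \<mu> I fg1 fg m x0] by blast
  obtain \<delta>N PN QN where cN: "directional_C2 x0 \<delta>N (gen_mean h k n \<nu>) PN QN"
    and QN: "\<And>v. QN v (diag x0) = (\<Sum>i\<in>UNIV. \<Sum>j\<in>UNIV. v $ i * v $ j * mean_hessian h k n \<nu> x0 i j)"
    using gen_mean_second_order[OF \<nu> I hk1 hk n x0] by blast
  note M = directional_C2D[OF cM] and N = directional_C2D[OF cN]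
  \<comment> \<open>In this direction the second derivative of the difference of the means is the
    quadratic form of the comparison matrix at \<open>v\<close>.\<close>
  define u where "u = extend_zero v"
  define S where "S = U \<inter> ({x0 - \<delta>M<..<x0 + \<delta>M} \<inter> {x0 - \<delta>N<..<x0 + \<delta>N})"
  have S: "open S" "x0 \<in> S" using U M(1) N(1) by (auto simp: S_def)
  obtain \<epsilon> where \<epsilon>: "\<epsilon> > 0" "\<And>s. \<bar>s\<bar> < \<epsilon> \<Longrightarrow> diag x0 + s *\<^sub>R u \<in> cube S"
    using line_in_open[OF open_cube[OF S(1)], of "diag x0" u] S by auto
  have in_M: "x \<in> cube {x0 - \<delta>M<..<x0 + \<delta>M}" and in_N: "x \<in> cube {x0 - \<delta>N<..<x0 + \<delta>N}" and in_U: "x \<in> cube U"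
    if "x \<in> cube S" for x :: "real ^ 'n option"
    by (rule cube_mono[OF that]; auto simp: S_def)+
  let ?G = "\<lambda>s. gen_mean h k n \<nu> (diag x0 + s *\<^sub>R u) - gen_mean f g m \<mu> (diag x0 + s *\<^sub>R u)"
  let ?G' = "\<lambda>s. PN u (diag x0 + s *\<^sub>R u) - PM u (diag x0 + s *\<^sub>R u)"
  have "QN u (diag x0) - QM u (diag x0) \<ge> 0"
  proof (rule second_derivative_nonneg_at_min[of \<epsilon> ?G ?G'])
    show "(?G has_real_derivative ?G' s) (at s)" if "\<bar>s\<bar> < \<epsilon>" for s
      by (intro DERIV_diff M N in_M in_N \<epsilon>(2) that)
    have "diag x0 + 0 *\<^sub>R u \<in> cube S" using S(2) by simp
    from DERIV_diff[OF N(3)[OF in_N[OF this]] M(3)[OF in_M[OF this]]]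
    show "(?G' has_real_derivative QN u (diag x0) - QM u (diag x0)) (at 0)" by simp
    show "?G s \<ge> 0" if "\<bar>s\<bar> < \<epsilon>" for s
      using le[OF in_U[OF \<epsilon>(2)[OF that]]] by simp
    have m1: "family_C1 I \<mu> m" and n1: "family_C1 I \<nu> n"
      using m n unfolding family_C2_def by auto
    show "?G 0 = 0"
      using gen_mean_diag_derivative(1)[OF \<mu> I fg1 m1 x0] gen_mean_diag_derivative(1)[OF \<nu> I hk1 n1 x0]
      by simp
  qed (rule \<epsilon>(1))
  then show ?thesis
    unfolding QM QN u_def comparison_matrix_quadratic_form .
qed

text \<open>Otherwise there are points converging to \<open>diag x0\<close> and directions in
  \<open>C\<close> at which \<open>q\<close> is negative. A subsequence of the directions converges
  in \<open>C\<close>, and joint convergence forces a nonpositive value at the diagonal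
  point.\<close>

lemma positive_near_compact:
  fixes q :: "real ^ 'd::finite \<Rightarrow> real ^ 'd \<Rightarrow> real"
  assumes "\<delta> > 0" and C: "compact C"
    and lim: "\<And>X V v. (\<And>n. X n \<in> cube {x0 - \<delta><..<x0 + \<delta>}) \<Longrightarrow> X \<longlonglongrightarrow> diag x0 \<Longrightarrow> V \<longlonglongrightarrow> v \<Longrightarrow>
        (\<lambda>n. q (V n) (X n)) \<longlonglongrightarrow> q v (diag x0)"
    and pos: "\<And>v. v \<in> C \<Longrightarrow> q v (diag x0) > 0"
  shows "\<exists>\<eta>>0. \<eta> \<le> \<delta> \<and> (\<forall>x\<in>cube {x0 - \<eta><..<x0 + \<eta>}. \<forall>v\<in>C. q v x \<ge> 0)"
proof (rule ccontr)
  assume neg: "\<not> ?thesis"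
  define \<eta> where "\<eta> n = \<delta> * inverse (real (Suc n))" for n
  have \<eta>: "\<eta> n > 0" "\<eta> n \<le> \<delta>" for n
    using \<open>\<delta> > 0\<close> by (auto simp: \<eta>_def field_simps)
  have "\<exists>x v. x \<in> cube {x0 - \<eta> n<..<x0 + \<eta> n} \<and> v \<in> C \<and> q v x < 0" for n
    using neg \<eta>[of n] by (meson not_le)
  then obtain X V where X: "\<And>n. X n \<in> cube {x0 - \<eta> n<..<x0 + \<eta> n}" and V: "\<And>n. V n \<in> C"
    and q: "\<And>n. q (V n) (X n) < 0" by metis
  have "\<eta> \<longlonglongrightarrow> \<delta> * 0" unfolding \<eta>_def by (intro tendsto_intros LIMSEQ_inverse_real_of_nat)
  then have \<eta>0: "\<eta> \<longlonglongrightarrow> 0" by simp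
  have "X \<longlonglongrightarrow> diag x0"
  proof (rule vec_tendstoI)
    fix i
    have between: "x0 - \<eta> n \<le> X n $ i" "X n $ i \<le> x0 + \<eta> n" for n
      using X[of n] by (auto simp: cube_def less_imp_le)
    have lims: "(\<lambda>n. x0 - \<eta> n) \<longlonglongrightarrow> x0" "(\<lambda>n. x0 + \<eta> n) \<longlonglongrightarrow> x0"
      using tendsto_diff[OF tendsto_const \<eta>0, of x0] tendsto_add[OF tendsto_const \<eta>0, of x0] by simp_all
    show "(\<lambda>n. X n $ i) \<longlonglongrightarrow> diag x0 $ i"
      unfolding diag_nth by (rule tendsto_sandwich[OF _ _ lims]) (simp_all add: between)
  qed
  obtain v r where v: "v \<in> C" and r: "strict_mono r" and Vr: "(V \<circ> r) \<longlonglongrightarrow> v"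
    using C V unfolding compact_def by metis
  have "(\<lambda>n. q ((V \<circ> r) n) ((X \<circ> r) n)) \<longlonglongrightarrow> q v (diag x0)"
  proof (rule lim[OF _ LIMSEQ_subseq_LIMSEQ[OF \<open>X \<longlonglongrightarrow> diag x0\<close> r] Vr])
    show "(X \<circ> r) n \<in> cube {x0 - \<delta><..<x0 + \<delta>}" for n
      unfolding o_def by (rule cube_mono[OF X]) (use \<eta>[of "r n"] in auto)
  qed
  then have "q v (diag x0) \<le> 0"
    by (rule LIMSEQ_le_const2) (use q in \<open>auto simp: less_imp_le\<close>)
  then show False using pos[OF v] by simp
qed

lemma sufficient_condition:
  fixes m :: "real ^ 'n::finite option \<Rightarrow> 't \<Rightarrow> real" and n :: "real ^ 'n option \<Rightarrow> 's \<Rightarrow> real"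
  assumes I: "open I" and \<mu>: "prob_space \<mu>" and \<nu>: "prob_space \<nu>"
    and fg1: "cheb_class 1 I f g" and hk1: "cheb_class 1 I h k"
    and fg: "cheb_class 2 I f g" and hk: "cheb_class 2 I h k"
    and m: "family_C2 I \<mu> m" and n: "family_C2 I \<nu> n"
    and U: "open U" "x0 \<in> U" "U \<subseteq> I"
    and first: "\<And>x i. x \<in> U \<Longrightarrow>
      bracket \<mu> (fpd i m) one_fam (diag x) = bracket \<nu> (fpd i n) one_fam (diag x)"
    and pos: "\<And>v. v \<noteq> 0 \<Longrightarrow> 0 < v \<bullet> (comparison_matrix f g m \<mu> h k n \<nu> x0 *v v)"
  shows "locally_smaller I x0 (gen_mean f g m \<mu>) (gen_mean h k n \<nu>)"
proof -
  let ?M = "gen_mean f g m \<mu>" and ?N = "gen_mean h k n \<nu>"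
  have x0: "x0 \<in> I" using U by blast
  have m1: "family_C1 I \<mu> m" and n1: "family_C1 I \<nu> n" using m n unfolding family_C2_def by auto
  obtain \<delta>M PM QM where cM: "directional_C2 x0 \<delta>M ?M PM QM"
    and QM: "\<And>v. QM v (diag x0) = (\<Sum>i\<in>UNIV. \<Sum>j\<in>UNIV. v $ i * v $ j * mean_hessian f g m \<mu> x0 i j)"
    using gen_mean_second_order[OF \<mu> I fg1 fg m x0] by blast
  obtain \<delta>N PN QN where cN: "directional_C2 x0 \<delta>N ?N PN QN"
    and QN: "\<And>v. QN v (diag x0) = (\<Sum>i\<in>UNIV. \<Sum>j\<in>UNIV. v $ i * v $ j * mean_hessian h k n \<nu> x0 i j)"
    using gen_mean_second_order[OF \<nu> I hk1 hk n x0] by blast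
  note M = directional_C2D[OF cM] and N = directional_C2D[OF cN]
  obtain d where "d > 0" and d: "\<And>y. \<bar>y - x0\<bar> < d \<Longrightarrow> y \<in> U"
    using U(1,2) unfolding open_dist dist_real_def by blast
  define \<delta> where "\<delta> = min d (min \<delta>M \<delta>N)"
  have "\<delta> > 0" using \<open>d > 0\<close> M(1) N(1) by (simp add: \<delta>_def)
  have J_U: "{x0 - \<delta><..<x0 + \<delta>} \<subseteq> U" by (auto simp: \<delta>_def abs_less_iff intro!: d)
  have in_M: "x \<in> cube {x0 - \<delta>M<..<x0 + \<delta>M}" and in_N: "x \<in> cube {x0 - \<delta>N<..<x0 + \<delta>N}"
    if "x \<in> cube {x0 - \<delta><..<x0 + \<delta>}" for x :: "real ^ 'n option"
    by (rule cube_mono[OF that]; auto simp: \<delta>_def)+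
  \<comment> \<open>The second derivative is quadratic in the direction only at the diagonal point
    by the formulas at hand; restricting to unit directions gives the compact set over which its
    sign is made uniform.\<close>
  define C where "C = sphere 0 1 \<inter> {u :: real ^ 'n option. u $ None = 0}"
  have "compact C"
    unfolding C_def by (intro compact_Int_closed compact_sphere closed_Collect_eq continuous_intros)
  have "\<exists>\<eta>>0. \<eta> \<le> \<delta> \<and> (\<forall>x\<in>cube {x0 - \<eta><..<x0 + \<eta>}. \<forall>u\<in>C. QN u x - QM u x \<ge> 0)"
  proof (rule positive_near_compact[OF \<open>\<delta> > 0\<close> \<open>compact C\<close>])
    show "(\<lambda>n. QN (V n) (X n) - QM (V n) (X n)) \<longlonglongrightarrow> QN v (diag x0) - QM v (diag x0)"
      if "\<And>n. X n \<in> cube {x0 - \<delta><..<x0 + \<delta>}" "X \<longlonglongrightarrow> diag x0" "V \<longlonglongrightarrow> v" for X V v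
      by (intro tendsto_diff M(4) N(4) in_M in_N that)
    fix u assume u: "u \<in> C"
    define v where "v = (\<chi> j. u $ Some j)"
    have uv: "u = extend_zero v"
      using u unfolding C_def vec_eq_iff by (auto simp: extend_zero_def v_def split: option.split)
    have "v \<noteq> 0"
    proof
      assume "v = 0"
      then have "u = 0" unfolding uv by (auto simp: vec_eq_iff extend_zero_def split: option.split)
      then show False using u by (simp add: C_def)
    qed
    from pos[OF this] show "0 < QN u (diag x0) - QM u (diag x0)"
      unfolding QM QN uv comparison_matrix_quadratic_form .
  qed
  then obtain \<eta> where \<eta>: "\<eta> > 0" "\<eta> \<le> \<delta>"
    and Q: "\<And>x u. x \<in> cube {x0 - \<eta><..<x0 + \<eta>} \<Longrightarrow> u \<in> C \<Longrightarrow> QN u x - QM u x \<ge> 0" by blast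
  have \<eta>\<delta>: "x \<in> cube {x0 - \<delta><..<x0 + \<delta>}" if "x \<in> cube {x0 - \<eta><..<x0 + \<eta>}" for x :: "real ^ 'n option"
    by (rule cube_mono[OF that]) (use \<eta>(2) in auto)
  have "?M x \<le> ?N x" if x: "x \<in> cube {x0 - \<eta><..<x0 + \<eta>}" for x
  proof (cases "x = diag (x $ None)")
    \<comment> \<open>A diagonal point offers no direction to normalise, but there both means take
      the same value.\<close>
    case True
    have "x $ None \<in> {x0 - \<delta><..<x0 + \<delta>}" using \<eta>\<delta>[OF x] by (simp add: cube_def)
    then have "x $ None \<in> I" using J_U U(3) by blast
    then have "?M (diag (x $ None)) = ?N (diag (x $ None))"
      using gen_mean_diag_derivative(1)[OF \<mu> I fg1 m1] gen_mean_diag_derivative(1)[OF \<nu> I hk1 n1] by simp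
    then show ?thesis using True by simp
  next
    case False
    \<comment> \<open>\<open>diag z\<close> is the diagonal point with the same last coordinate as
      \<open>x\<close>, so \<open>x - diag z\<close> has last coordinate 0 and its normalisation
      \<open>u\<close> lies in \<open>C\<close>.\<close>
    define z r u where "z = x $ None" and "r = norm (x - diag z)" and "u = (x - diag z) /\<^sub>R r"
    have r: "r > 0" using False by (simp add: r_def z_def)
    have u: "u \<in> C" using r by (simp add: C_def u_def z_def) (simp add: r_def z_def)
    have xu: "x = diag z + r *\<^sub>R u" using r by (simp add: u_def)
    have z\<eta>: "z \<in> {x0 - \<eta><..<x0 + \<eta>}" using x by (simp add: cube_def z_def)
    have zU: "z \<in> U" using z\<eta> \<eta>(2) J_U by fastforce
    then have zI: "z \<in> I" using U(3) by blast
    have seg: "diag z + s *\<^sub>R u \<in> cube {x0 - \<eta><..<x0 + \<eta>}" if s: "0 \<le> s" "s \<le> r" for s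
    proof -
      have "(diag z + s *\<^sub>R u) $ i \<in> {x0 - \<eta><..<x0 + \<eta>}" for i
      proof -
        \<comment> \<open>In each coordinate the segment runs between \<open>z\<close> and
          \<open>x $ i\<close>, which both lie in the interval.\<close>
        have "(1 - s / r) *\<^sub>R z + (s / r) *\<^sub>R (x $ i) \<in> {x0 - \<eta><..<x0 + \<eta>}"
          using x z\<eta> s r
          by (intro convexD[OF convex_real_interval(8)]) (auto simp: cube_def)
        moreover have "(1 - s / r) *\<^sub>R z + (s / r) *\<^sub>R (x $ i) = (diag z + s *\<^sub>R u) $ i"
          using r by (simp add: u_def field_simps)
        ultimately show ?thesis by simp
      qed
      then show ?thesis by (simp add: cube_def)
    qed
    let ?G = "\<lambda>s. ?N (diag z + s *\<^sub>R u) - ?M (diag z + s *\<^sub>R u)"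
    let ?G' = "\<lambda>s. PN u (diag z + s *\<^sub>R u) - PM u (diag z + s *\<^sub>R u)"
    let ?G'' = "\<lambda>s. QN u (diag z + s *\<^sub>R u) - QM u (diag z + s *\<^sub>R u)"
    have "?G r \<ge> 0"
    proof (rule nonneg_of_second_derivative_nonneg[of r ?G ?G' ?G''])
      show "(?G has_real_derivative ?G' s) (at s)" "(?G' has_real_derivative ?G'' s) (at s)"
        if "0 \<le> s" "s \<le> r" for s
        by (intro DERIV_diff M N in_M in_N \<eta>\<delta> seg that)+
      show "?G'' s \<ge> 0" if "0 \<le> s" "s \<le> r" for s by (intro Q seg that u)
      show "?G 0 = 0"
        using gen_mean_diag_derivative(1)[OF \<mu> I fg1 m1 zI] gen_mean_diag_derivative(1)[OF \<nu> I hk1 n1 zI] by simp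
      note z = \<eta>\<delta>[OF seg[OF order_refl less_imp_le[OF r]]]
      \<comment> \<open>\<open>PM\<close> stems from the localisation at \<open>x0\<close>, the
        formula with brackets from the one at \<open>z\<close>; uniqueness of the derivative
        identifies them.\<close>
      have "PM u (diag z) = (\<Sum>i\<in>UNIV. u $ i * bracket \<mu> (fpd i m) one_fam (diag z))"
        using DERIV_unique[OF M(2)[OF in_M[OF z]] gen_mean_diag_derivative(2)[OF \<mu> I fg1 m1 zI]] by simp
      moreover have "PN u (diag z) = (\<Sum>i\<in>UNIV. u $ i * bracket \<nu> (fpd i n) one_fam (diag z))"
        using DERIV_unique[OF N(2)[OF in_N[OF z]] gen_mean_diag_derivative(2)[OF \<nu> I hk1 n1 zI]] by simp
      ultimately show "?G' 0 = 0" using first[OF zU] by simp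
    qed (use r in simp)
    then show ?thesis unfolding xu by simp
  qed
  moreover have "{x0 - \<eta><..<x0 + \<eta>} \<subseteq> I" using J_U \<eta>(2) U(3) by fastforce
  ultimately show ?thesis
    unfolding locally_smaller_def using \<eta>(1)
    by (intro exI[of _ "{x0 - \<eta><..<x0 + \<eta>}"]) auto
qed

theorem corollary9:
  fixes I :: "real set"
    and \<mu> :: "'t measure" and \<nu> :: "'s measure"
    and f g h k :: "real \<Rightarrow> real"
    and m :: "real ^ 'n::finite option \<Rightarrow> 't \<Rightarrow> real"
    and n :: "real ^ 'n option \<Rightarrow> 's \<Rightarrow> real"
    and x0 :: real
  assumes "is_interval I" and "open I" and "I \<noteq> {}"
    and "prob_space \<mu>" and "prob_space \<nu>"
    and "cheb_class 1 I f g" and "cheb_class 1 I h k"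
    and "family_C1 I \<mu> m" and "family_C1 I \<nu> n"
    and "x0 \<in> I"
  shows
    "(locally_smaller I x0 (gen_mean f g m \<mu>) (gen_mean h k n \<nu>) \<longrightarrow>
        (\<exists>U. open U \<and> x0 \<in> U \<and> U \<subseteq> I \<and>
          (\<forall>x \<in> U. \<forall>i. bracket \<mu> (fpd i m) one_fam (diag x) = bracket \<nu> (fpd i n) one_fam (diag x))) \<and>
        (cheb_class 2 I f g \<and> cheb_class 2 I h k \<and> family_C2 I \<mu> m \<and> family_C2 I \<nu> n \<longrightarrow>
          positive_semidefinite (comparison_matrix f g m \<mu> h k n \<nu> x0))) \<and>
     (cheb_class 2 I f g \<and> cheb_class 2 I h k \<and> family_C2 I \<mu> m \<and> family_C2 I \<nu> n \<and>
        (\<exists>U. open U \<and> x0 \<in> U \<and> U \<subseteq> I \<and>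
          (\<forall>x \<in> U. \<forall>i. bracket \<mu> (fpd i m) one_fam (diag x) = bracket \<nu> (fpd i n) one_fam (diag x))) \<and>
        positive_definite (comparison_matrix f g m \<mu> h k n \<nu> x0) \<longrightarrow>
        locally_smaller I x0 (gen_mean f g m \<mu>) (gen_mean h k n \<nu>))"
proof (intro conjI impI)
  note basic = assms(2,4-9)
  assume "locally_smaller I x0 (gen_mean f g m \<mu>) (gen_mean h k n \<nu>)"
  then obtain U where U: "open U" "x0 \<in> U" "U \<subseteq> I"
    and le: "\<And>x. x \<in> cube U \<Longrightarrow> gen_mean f g m \<mu> x \<le> gen_mean h k n \<nu> x"
    unfolding locally_smaller_def by blast
  show "\<exists>U. open U \<and> x0 \<in> U \<and> U \<subseteq> I \<and>
      (\<forall>x\<in>U. \<forall>i. bracket \<mu> (fpd i m) one_fam (diag x) = bracket \<nu> (fpd i n) one_fam (diag x))"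
    using U first_order_condition[OF basic U(1,3) le] by blast
  assume *: "cheb_class 2 I f g \<and> cheb_class 2 I h k \<and> family_C2 I \<mu> m \<and> family_C2 I \<nu> n"
  then show "positive_semidefinite (comparison_matrix f g m \<mu> h k n \<nu> x0)"
    unfolding positive_semidefinite_def
    using transpose_comparison_matrix[OF assms(2) _ _ assms(10)]
      second_order_condition[OF assms(2,4-7) _ _ _ _ U le] by blast
next
  assume *: "cheb_class 2 I f g \<and> cheb_class 2 I h k \<and> family_C2 I \<mu> m \<and> family_C2 I \<nu> n \<and>
    (\<exists>U. open U \<and> x0 \<in> U \<and> U \<subseteq> I \<and>
      (\<forall>x\<in>U. \<forall>i. bracket \<mu> (fpd i m) one_fam (diag x) = bracket \<nu> (fpd i n) one_fam (diag x))) \<and>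
    positive_definite (comparison_matrix f g m \<mu> h k n \<nu> x0)"
  then obtain U where U: "open U" "x0 \<in> U" "U \<subseteq> I"
    and first: "\<And>x i. x \<in> U \<Longrightarrow> bracket \<mu> (fpd i m) one_fam (diag x) = bracket \<nu> (fpd i n) one_fam (diag x)"
    by blast
  have "v \<noteq> 0 \<Longrightarrow> 0 < v \<bullet> (comparison_matrix f g m \<mu> h k n \<nu> x0 *v v)" for v
    using * unfolding positive_definite_def by blast
  with * show "locally_smaller I x0 (gen_mean f g m \<mu>) (gen_mean h k n \<nu>)"
    by (intro sufficient_condition[OF assms(2,4-7) _ _ _ _ U first]) auto
qed

end
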